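(* Consider the time-invariant mean-field system $$x_{k+1}=(Ax_k+\bar AEx_k+Bu_k+\bar BEu_k)+(Cx_k+\bar CEx_k+Du_k+\bar DEu_k)w_k,\quad x_0=\xi,$$ and the cost $$J=\sum_{k=0}^\infty E[x_k'Qx_k+(Ex_k)'\bar QEx_k+u_k'Ru_k+(Eu_k)'\bar REu_k].$$ Assume $R>0$, $R+\bar R>0$, $Q\ge0$, $Q+\bar Q\ge0$, and that $(A,\bar A,C,\bar C,\mathcal Q^{1/2})$ is exactly detectable. Then the system is stabilizable in the mean square sense if and only if there exists a unique solution $P,\bar P$ to the coupled algebraic Riccati equation $$P=Q+A'PA+\sigma^2C'PC-[M^{(1)}]'[\Upsilon^{(1)}]^{-1}M^{(1)},$$ $$\begin{aligned}\bar P=\;&\bar Q+A'P\bar A+\sigma^2C'P\bar C+\bar A'PA+\sigma^2\bar C'PC+\bar A'P\bar A+\sigma^2\bar C'P\bar C\\&+(A+\bar A)'\bar P(A+\bar A)+[M^{(1)}]'[\Upsilon^{(1)}]^{-1}M^{(1)}-[M^{(2)}]'[\Upsilon^{(2)}]^{-1}M^{(2)}\end{aligned}$$ satisfying $P\ge0$ and $P+\bar P\ge0$, where $$\Upsilon^{(1)}=R+B'PB+\sigma^2D'PD,\qquad M^{(1)}=B'PA+\sigma^2D'PC,$$ $$\Upsilon^{(2)}=R+\bar R+(B+\bar B)'(P+\bar P)(B+\bar B)+\sigma^2(D+\bar D)'P(D+\bar D),$$ $$M^{(2)}=(B+\bar B)'(P+\bar P)(A+\bar A)+\sigma^2(D+\bar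 D)'P(C+\bar C).$$ In this case, a stabilizing controller is $$u_k=Kx_k+\bar KEx_k,\quad K=-[\Upsilon^{(1)}]^{-1}M^{(1)},\quad \bar K=-\{[\Upsilon^{(2)}]^{-1}M^{(2)}-[\Upsilon^{(1)}]^{-1}M^{(1)}\}.$$ Moreover, this controller minimizes the cost $J$ (among stabilizing controllers), and the optimal cost is $$J^*=E(x_0'Px_0)+(Ex_0)'\bar PEx_0.$$
   Context: $A,\bar A,C,\bar C\in\mathcal R^{n\times n}$ and $B,\bar B,D,\bar D\in\mathcal R^{n\times m}$ are constant; $Q,\bar Q,R,\bar R$ are constant symmetric matrices; $P,\bar P$ range over real symmetric matrices. A prime denotes transpose; $>0$ ($\ge0$) means positive (semi-)definite. $(w_k)_{k\ge0}$ is scalar white noise (independent, independent of $x_0$, zero mean, variance $\sigma^2$), and initial states are square-integrable random vectors. $\mathcal F_k$ is the augmented $\sigma$-algebra generated by $x_0,w_0,\dots,w_k$, and $\mathcal F_{-1}$ is the one generated by $x_0$. A random vector $x$ is called zero ($x=0$) if $E(x'x)=0$. Stability: the system with $u_k=0$ is asymptotically mean square stable if $\lim_{k\to\infty}E(x_k'x_k)=0$ for any initial value $x_0$. Stabilizability: the system is stabilizable in the mean square sense if there is an $\mathcal F_{k-1}$-measurable linear controller in terms of $x_k$ and $Ex_k$, $u_k=Lx_k+\bar LEx_k$ with constant matrices $L,\bar L$, such that for any random vector $x_0$ the closed loop is asymptotically mean square stable. The optimization problem is to find an $\mathcal F_{k-1}$-measurable linear controller in terms of $x_k$ and $Ex_k$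 that minimizes $J$ and stabilizes the system in the mean square sense. Exact detectability: let $\mathcal Q=\begin{bmatrix}Q&0\\ 0&Q+\bar Q\end{bmatrix}$, $\mathbb X_k=\begin{bmatrix}x_k-Ex_k\\ E x_k\end{bmatrix}$, and consider $x_{k+1}=(Ax_k+\bar AEx_k)+(Cx_k+\bar CEx_k)w_k$, $Y_k=\mathcal Q^{1/2}\mathbb X_k$. This system, denoted $(A,\bar A,C,\bar C,\mathcal Q^{1/2})$, is exactly detectable if for any $N\ge0$: $Y_k=0$ for all $0\le k\le N$ implies $\lim_{k\to+\infty}E(x_k'x_k)=0$.
   Formalization: The formal theorem also assumes that the probability space carries at least one square-integrable initial state, independent of the noise, that is not almost surely constant; without this the equivalence fails, since P depends on dynamics that are never excited. *)

theory Defs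
  imports "HOL-Probability.Probability"
begin

section \<open>Matrices\<close>

definition pos_semidef :: "real^'n^'n \<Rightarrow> bool" where
  "pos_semidef S \<longleftrightarrow> transpose S = S \<and> (\<forall>v. 0 \<le> v \<bullet> (S *v v))"

definition pos_def :: "real^'n^'n \<Rightarrow> bool" where
  "pos_def S \<longleftrightarrow> transpose S = S \<and> (\<forall>v. v \<noteq> 0 \<longrightarrow> 0 < v \<bullet> (S *v v))"

text \<open>\<open>is_psd_sqrt S T\<close> says \<open>S = T\<^sup>1\<^sup>/\<^sup>2\<close>; the positive semidefinite square root of a positive
  semidefinite \<open>T\<close> exists and is unique.\<close>

definition is_psd_sqrt :: "real^'n^'n \<Rightarrow> real^'n^'n \<Rightarrow> bool" where
  "is_psd_sqrt S T \<longleftrightarrow> pos_semidef S \<and> S ** S = T"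

definition block_diag :: "real^'n^'n \<Rightarrow> real^'m^'m \<Rightarrow> real^('n + 'm)^('n + 'm)" where
  "block_diag S T = (\<chi> i j. case i of
       Inl a \<Rightarrow> (case j of Inl b \<Rightarrow> S $ a $ b | Inr b \<Rightarrow> 0)
     | Inr a \<Rightarrow> (case j of Inl b \<Rightarrow> 0 | Inr b \<Rightarrow> T $ a $ b))"

definition stack_vec :: "real^'n \<Rightarrow> real^'m \<Rightarrow> real^('n + 'm)" where
  "stack_vec x y = (\<chi> i. case i of Inl a \<Rightarrow> x $ a | Inr b \<Rightarrow> y $ b)"


section \<open>Noise, initial states and information\<close>

definition second_moment :: "'w measure \<Rightarrow> ('w \<Rightarrow> real^'n) \<Rightarrow> real" where
  "second_moment M x = (\<integral>\<omega>. x \<omega> \<bullet> x \<omega> \<partial>M)"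

text \<open>The convention \<open>x = 0\<close> for random vectors. It is only meaningful, and only used, for
  square-integrable \<open>x\<close> (the Bochner integral of a non-integrable function is \<open>0\<close>).\<close>

definition rv_zero :: "'w measure \<Rightarrow> ('w \<Rightarrow> real^'n) \<Rightarrow> bool" where
  "rv_zero M x \<longleftrightarrow> second_moment M x = 0"

definition square_integrable :: "'w measure \<Rightarrow> ('w \<Rightarrow> real^'n) \<Rightarrow> bool" where
  "square_integrable M x \<longleftrightarrow> x \<in> borel_measurable M \<and> integrable M (\<lambda>\<omega>. x \<omega> \<bullet> x \<omega>)"

definition white_noise :: "'w measure \<Rightarrow> (nat \<Rightarrow> 'w \<Rightarrow> real) \<Rightarrow> real \<Rightarrow> bool" where
  "white_noise M w \<sigma> \<longleftrightarrow> prob_space.indep_vars M (\<lambda>_. borel) w UNIV \<and>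
     (\<forall>k. integrable M (\<lambda>\<omega>. (w k \<omega>)\<^sup>2) \<and> (\<integral>\<omega>. w k \<omega> \<partial>M) = 0 \<and>
          prob_space.variance M (w k) = \<sigma>\<^sup>2)"

text \<open>Independence of \<open>x0\<close> from the whole sequence \<open>w\<close> is stated through the generated
  \<open>\<sigma>\<close>-algebras, because \<^const>\<open>prob_space.indep_var\<close> needs a common codomain type.\<close>

definition initial_state ::
    "'w measure \<Rightarrow> (nat \<Rightarrow> 'w \<Rightarrow> real) \<Rightarrow> ('w \<Rightarrow> real^'n) \<Rightarrow> bool" where
  "initial_state M w x0 \<longleftrightarrow> square_integrable M x0 \<and>
     prob_space.indep_set M
       (sets (vimage_algebra (space M) x0 borel))
       (sets (vimage_algebra (space M) (\<lambda>\<omega> k. w k \<omega>) (Pi\<^sub>M UNIV (\<lambda>_. borel))))"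

text \<open>\<open>past_info M x0 w k\<close> is \<open>\<F>\<close> with index \<open>k - 1\<close>: generated by \<open>x0\<close> and \<open>w i\<close> for \<open>i < k\<close>,
  and augmented by the null sets of \<open>M\<close>.\<close>

definition past_info ::
    "'w measure \<Rightarrow> ('w \<Rightarrow> real^'n) \<Rightarrow> (nat \<Rightarrow> 'w \<Rightarrow> real) \<Rightarrow> nat \<Rightarrow> 'w measure" where
  "past_info M x0 w k = sigma (space M)
     ({x0 -` S \<inter> space M | S. S \<in> sets borel} \<union>
      {w i -` S \<inter> space M | i S. i < k \<and> S \<in> sets borel} \<union>
      null_sets M)"


section \<open>The mean-field system\<close>

text \<open>Barred matrices carry the suffix \<open>b\<close>.\<close>

definition mf_system ::
    "'w measure \<Rightarrow> (nat \<Rightarrow> 'w \<Rightarrow> real) \<Rightarrow>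
     real^'n^'n \<Rightarrow> real^'n^'n \<Rightarrow> real^'m^'n \<Rightarrow> real^'m^'n \<Rightarrow>
     real^'n^'n \<Rightarrow> real^'n^'n \<Rightarrow> real^'m^'n \<Rightarrow> real^'m^'n \<Rightarrow>
     (nat \<Rightarrow> 'w \<Rightarrow> real^'n) \<Rightarrow> (nat \<Rightarrow> 'w \<Rightarrow> real^'m) \<Rightarrow> bool" where
  "mf_system M w A Ab B Bb C Cb D Db x u \<longleftrightarrow>
     (\<forall>k \<omega>. x (Suc k) \<omega> =
        (A *v x k \<omega> + Ab *v (integral\<^sup>L M (x k)) + B *v u k \<omega> + Bb *v (integral\<^sup>L M (u k))) +
        w k \<omega> *\<^sub>R
        (C *v x k \<omega> + Cb *v (integral\<^sup>L M (x k)) + D *v u k \<omega> + Db *v (integral\<^sup>L M (u k))))"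

definition linear_feedback ::
    "'w measure \<Rightarrow> (nat \<Rightarrow> real^'n^'m) \<Rightarrow> (nat \<Rightarrow> real^'n^'m) \<Rightarrow>
     (nat \<Rightarrow> 'w \<Rightarrow> real^'n) \<Rightarrow> (nat \<Rightarrow> 'w \<Rightarrow> real^'m) \<Rightarrow> bool" where
  "linear_feedback M L Lb x u \<longleftrightarrow>
     (\<forall>k \<omega>. u k \<omega> = L k *v x k \<omega> + Lb k *v (integral\<^sup>L M (x k)))"

definition closed_loop ::
    "'w measure \<Rightarrow> (nat \<Rightarrow> 'w \<Rightarrow> real) \<Rightarrow>
     real^'n^'n \<Rightarrow> real^'n^'n \<Rightarrow> real^'m^'n \<Rightarrow> real^'m^'n \<Rightarrow>
     real^'n^'n \<Rightarrow> real^'n^'n \<Rightarrow> real^'m^'n \<Rightarrow> real^'m^'n \<Rightarrow>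
     (nat \<Rightarrow> real^'n^'m) \<Rightarrow> (nat \<Rightarrow> real^'n^'m) \<Rightarrow>
     (nat \<Rightarrow> 'w \<Rightarrow> real^'n) \<Rightarrow> (nat \<Rightarrow> 'w \<Rightarrow> real^'m) \<Rightarrow> bool" where
  "closed_loop M w A Ab B Bb C Cb D Db L Lb x u \<longleftrightarrow>
     initial_state M w (x 0) \<and> mf_system M w A Ab B Bb C Cb D Db x u \<and>
     linear_feedback M L Lb x u"

text \<open>The gains may depend on time; constant gains are constant sequences.\<close>

definition stabilizing ::
    "'w measure \<Rightarrow> (nat \<Rightarrow> 'w \<Rightarrow> real) \<Rightarrow>
     real^'n^'n \<Rightarrow> real^'n^'n \<Rightarrow> real^'m^'n \<Rightarrow> real^'m^'n \<Rightarrow>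
     real^'n^'n \<Rightarrow> real^'n^'n \<Rightarrow> real^'m^'n \<Rightarrow> real^'m^'n \<Rightarrow>
     (nat \<Rightarrow> real^'n^'m) \<Rightarrow> (nat \<Rightarrow> real^'n^'m) \<Rightarrow> bool" where
  "stabilizing M w A Ab B Bb C Cb D Db L Lb \<longleftrightarrow>
     (\<forall>x u. closed_loop M w A Ab B Bb C Cb D Db L Lb x u \<longrightarrow>
        (\<forall>k. u k \<in> borel_measurable (past_info M (x 0) w k)) \<and>
        (\<lambda>k. second_moment M (x k)) \<longlonglongrightarrow> 0)"

definition ms_stabilizable ::
    "'w measure \<Rightarrow> (nat \<Rightarrow> 'w \<Rightarrow> real) \<Rightarrow>
     real^'n^'n \<Rightarrow> real^'n^'n \<Rightarrow> real^'m^'n \<Rightarrow> real^'m^'n \<Rightarrow>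
     real^'n^'n \<Rightarrow> real^'n^'n \<Rightarrow> real^'m^'n \<Rightarrow> real^'m^'n \<Rightarrow> bool" where
  "ms_stabilizable M w A Ab B Bb C Cb D Db \<longleftrightarrow>
     (\<exists>L Lb. stabilizing M w A Ab B Bb C Cb D Db (\<lambda>_. L) (\<lambda>_. Lb))"

text \<open>\<open>S\<close> is the output matrix, acting on the stacked vector of \<open>x k - E (x k)\<close> and \<open>E (x k)\<close>.\<close>

definition exactly_detectable ::
    "'w measure \<Rightarrow> (nat \<Rightarrow> 'w \<Rightarrow> real) \<Rightarrow>
     real^'n^'n \<Rightarrow> real^'n^'n \<Rightarrow> real^'n^'n \<Rightarrow> real^'n^'n \<Rightarrow>
     real^('n + 'n)^('n + 'n) \<Rightarrow> bool" where
  "exactly_detectable M w A Ab C Cb S \<longleftrightarrow>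
     (\<forall>x :: nat \<Rightarrow> 'w \<Rightarrow> real^'n.
        initial_state M w (x 0) \<longrightarrow>
        (\<forall>k \<omega>. x (Suc k) \<omega> =
           (A *v x k \<omega> + Ab *v (integral\<^sup>L M (x k))) +
           w k \<omega> *\<^sub>R (C *v x k \<omega> + Cb *v (integral\<^sup>L M (x k)))) \<longrightarrow>
        (\<forall>N. (\<forall>k\<le>N. rv_zero M
                 (\<lambda>\<omega>. S *v stack_vec (x k \<omega> - integral\<^sup>L M (x k)) (integral\<^sup>L M (x k)))) \<longrightarrow>
             (\<lambda>k. second_moment M (x k)) \<longlonglongrightarrow> 0))"

text \<open>The cost is valued in the extended reals, since it may be infinite.\<close>

definition mf_cost ::
    "'w measure \<Rightarrow> real^'n^'n \<Rightarrow> real^'n^'n \<Rightarrow> real^'m^'m \<Rightarrow> real^'m^'m \<Rightarrow>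
     (nat \<Rightarrow> 'w \<Rightarrow> real^'n) \<Rightarrow> (nat \<Rightarrow> 'w \<Rightarrow> real^'m) \<Rightarrow> ereal" where
  "mf_cost M Q Qb R Rb x u = (\<Sum>k. ereal (\<integral>\<omega>.
       (x k \<omega> \<bullet> (Q *v x k \<omega>) + integral\<^sup>L M (x k) \<bullet> (Qb *v integral\<^sup>L M (x k)) +
        u k \<omega> \<bullet> (R *v u k \<omega>) + integral\<^sup>L M (u k) \<bullet> (Rb *v integral\<^sup>L M (u k))) \<partial>M))"


section \<open>The coupled algebraic Riccati equation\<close>

definition Upsilon1 ::
    "real \<Rightarrow> real^'m^'n \<Rightarrow> real^'m^'n \<Rightarrow> real^'m^'m \<Rightarrow> real^'n^'n \<Rightarrow> real^'m^'m" where
  "Upsilon1 \<sigma> B D R P = R + transpose B ** P ** B + \<sigma>\<^sup>2 *\<^sub>R (transpose D ** P ** D)"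

definition M1 ::
    "real \<Rightarrow> real^'n^'n \<Rightarrow> real^'m^'n \<Rightarrow> real^'n^'n \<Rightarrow> real^'m^'n \<Rightarrow> real^'n^'n \<Rightarrow> real^'n^'m" where
  "M1 \<sigma> A B C D P = transpose B ** P ** A + \<sigma>\<^sup>2 *\<^sub>R (transpose D ** P ** C)"

definition Upsilon2 ::
    "real \<Rightarrow> real^'m^'n \<Rightarrow> real^'m^'n \<Rightarrow> real^'m^'n \<Rightarrow> real^'m^'n \<Rightarrow>
     real^'m^'m \<Rightarrow> real^'m^'m \<Rightarrow> real^'n^'n \<Rightarrow> real^'n^'n \<Rightarrow> real^'m^'m" where
  "Upsilon2 \<sigma> B Bb D Db R Rb P Pb =
     R + Rb + transpose (B + Bb) ** (P + Pb) ** (B + Bb) +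
     \<sigma>\<^sup>2 *\<^sub>R (transpose (D + Db) ** P ** (D + Db))"

definition M2 ::
    "real \<Rightarrow> real^'n^'n \<Rightarrow> real^'n^'n \<Rightarrow> real^'m^'n \<Rightarrow> real^'m^'n \<Rightarrow>
     real^'n^'n \<Rightarrow> real^'n^'n \<Rightarrow> real^'m^'n \<Rightarrow> real^'m^'n \<Rightarrow>
     real^'n^'n \<Rightarrow> real^'n^'n \<Rightarrow> real^'n^'m" where
  "M2 \<sigma> A Ab B Bb C Cb D Db P Pb =
     transpose (B + Bb) ** (P + Pb) ** (A + Ab) +
     \<sigma>\<^sup>2 *\<^sub>R (transpose (D + Db) ** P ** (C + Cb))"

definition coupled_riccati ::
    "real \<Rightarrow> real^'n^'n \<Rightarrow> real^'n^'n \<Rightarrow> real^'m^'n \<Rightarrow> real^'m^'n \<Rightarrow>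
     real^'n^'n \<Rightarrow> real^'n^'n \<Rightarrow> real^'m^'n \<Rightarrow> real^'m^'n \<Rightarrow>
     real^'n^'n \<Rightarrow> real^'n^'n \<Rightarrow> real^'m^'m \<Rightarrow> real^'m^'m \<Rightarrow>
     real^'n^'n \<Rightarrow> real^'n^'n \<Rightarrow> bool" where
  "coupled_riccati \<sigma> A Ab B Bb C Cb D Db Q Qb R Rb P Pb \<longleftrightarrow>
     (let U1 = Upsilon1 \<sigma> B D R P;
          N1 = M1 \<sigma> A B C D P;
          U2 = Upsilon2 \<sigma> B Bb D Db R Rb P Pb;
          N2 = M2 \<sigma> A Ab B Bb C Cb D Db P Pb
      in P = Q + transpose A ** P ** A + \<sigma>\<^sup>2 *\<^sub>R (transpose C ** P ** C)
             - transpose N1 ** matrix_inv U1 ** N1 \<and>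
         Pb = Qb + transpose A ** P ** Ab + \<sigma>\<^sup>2 *\<^sub>R (transpose C ** P ** Cb)
             + transpose Ab ** P ** A + \<sigma>\<^sup>2 *\<^sub>R (transpose Cb ** P ** C)
             + transpose Ab ** P ** Ab + \<sigma>\<^sup>2 *\<^sub>R (transpose Cb ** P ** Cb)
             + transpose (A + Ab) ** Pb ** (A + Ab)
             + transpose N1 ** matrix_inv U1 ** N1
             - transpose N2 ** matrix_inv U2 ** N2)"

definition riccati_solution ::
    "real \<Rightarrow> real^'n^'n \<Rightarrow> real^'n^'n \<Rightarrow> real^'m^'n \<Rightarrow> real^'m^'n \<Rightarrow>
     real^'n^'n \<Rightarrow> real^'n^'n \<Rightarrow> real^'m^'n \<Rightarrow> real^'m^'n \<Rightarrow>
     real^'n^'n \<Rightarrow> real^'n^'n \<Rightarrow> real^'m^'m \<Rightarrow> real^'m^'m \<Rightarrow>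
     real^'n^'n \<Rightarrow> real^'n^'n \<Rightarrow> bool" where
  "riccati_solution \<sigma> A Ab B Bb C Cb D Db Q Qb R Rb P Pb \<longleftrightarrow>
     transpose P = P \<and> transpose Pb = Pb \<and>
     coupled_riccati \<sigma> A Ab B Bb C Cb D Db Q Qb R Rb P Pb \<and>
     pos_semidef P \<and> pos_semidef (P + Pb)"

definition gain_K ::
    "real \<Rightarrow> real^'n^'n \<Rightarrow> real^'m^'n \<Rightarrow> real^'n^'n \<Rightarrow> real^'m^'n \<Rightarrow>
     real^'m^'m \<Rightarrow> real^'n^'n \<Rightarrow> real^'n^'m" where
  "gain_K \<sigma> A B C D R P = - (matrix_inv (Upsilon1 \<sigma> B D R P) ** M1 \<sigma> A B C D P)"

definition gain_Kb ::
    "real \<Rightarrow> real^'n^'n \<Rightarrow> real^'n^'n \<Rightarrow> real^'m^'n \<Rightarrow> real^'m^'n \<Rightarrow>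
     real^'n^'n \<Rightarrow> real^'n^'n \<Rightarrow> real^'m^'n \<Rightarrow> real^'m^'n \<Rightarrow>
     real^'m^'m \<Rightarrow> real^'m^'m \<Rightarrow> real^'n^'n \<Rightarrow> real^'n^'n \<Rightarrow> real^'n^'m" where
  "gain_Kb \<sigma> A Ab B Bb C Cb D Db R Rb P Pb =
     - (matrix_inv (Upsilon2 \<sigma> B Bb D Db R Rb P Pb) ** M2 \<sigma> A Ab B Bb C Cb D Db P Pb
        - matrix_inv (Upsilon1 \<sigma> B D R P) ** M1 \<sigma> A B C D P)"

end

theory Submission
  imports Defs
begin

text \<open>Write \<open>\<Pi> = P + Pb\<close>. Splitting \<open>x\<^sub>k\<close> into its deviation from the mean and its mean turns the
  closed loop into a linear map on pairs \<open>(P, \<Pi>)\<close> of quadratic forms: the moment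
  \<open>W x p = E[e' P e] + m' \<Pi> m\<close> satisfies \<open>W x\<^sub>k\<^sub>+\<^sub>1 p = W x\<^sub>k (step p)\<close>, and the coupled Riccati equation
  becomes a fixed-point equation \<open>p = Ric p\<close>, with \<open>Ric p \<le> cost + step p\<close> and equality for the
  feedback gain of \<open>p\<close>, by completing the square. If some feedback stabilises, value iteration from
  \<open>0\<close> increases and is bounded by the cost of that feedback, so its limit is a fixed point.
  Conversely, a fixed point \<open>p\<close> is a Lyapunov element for its own feedback; if that loop were unstable, a
  limit of normalised orbit sums would be a nonzero state of zero cost that does not decay, although
  with zero cost it evolves without control, against exact detectability. Telescoping
  \<open>W x\<^sub>k p\<close> gives optimality, and uniqueness because every fixed point equals the optimal cost.\<close>

section \<open>Quadratic forms and symmetric matrices\<close>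

text \<open>Limits of normalised orbit sums are functionals on pairs of forms, and nothing exhibits
  them as moments of actual random vectors. Stability is therefore argued in the dual cone, and
  states enter only through \<open>moment\<close> and through test states that evaluate a form at a
  single vector. Two facts that would be immediate for states become estimates for functionals: zero
  cost means no control action, and zero state cost means decay of the free motion. The error terms
  in both are multiples of the cost whose constants may blow up; they disappear because the
  functional vanishes there. Exact detectability is applied at horizon 0: zero output at time 0
  forces decay, which is a condition on the kernels of \<open>Q\<close> and \<open>Q + Qb\<close>
  and can be stated for forms. A pair of forms must be recoverable from moments of initial states.
  Constant states only see the second form; the nondegenerate initial state in the hypotheses makes
  every direction of the deviation available.\<close>

definition quad :: "real^'n^'n \<Rightarrow> real^'n \<Rightarrow> real" where
  "quad P v = v \<bullet> (P *v v)"

text \<open>In the Frobenius inner product, rank-one matrices represent evaluation of a bilinear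
  form (\<open>inner_outer\<close>); this is how Cauchy-Schwarz and dual functionals reach single
  vectors.\<close>

definition outer :: "real^'n \<Rightarrow> real^'m \<Rightarrow> real^'m^'n" where
  "outer a b = (\<chi> i j. a $ i * b $ j)"

lemma inner_outer: "outer a b \<bullet> P = a \<bullet> (P *v b)"
  by (simp add: outer_def inner_vec_def matrix_vector_mult_def sum_distrib_left mult_ac)

lemma norm_outer: "norm (outer a b) = norm a * norm b"
proof -
  have "outer a b \<bullet> outer a b = (\<Sum>i\<in>UNIV. \<Sum>j\<in>UNIV. (a $ i * a $ i) * (b $ j * b $ j))"
    by (simp add: outer_def inner_vec_def mult_ac)
  also have "\<dots> = (a \<bullet> a) * (b \<bullet> b)"
    unfolding sum_product[symmetric] by (simp add: inner_vec_def)
  finally show ?thesis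
    by (simp add: norm_eq_sqrt_inner real_sqrt_mult)
qed

lemma abs_bilinear_le:
  fixes a :: "real^'n" and b :: "real^'m"
  shows "\<bar>a \<bullet> (P *v b)\<bar> \<le> norm P * (norm a * norm b)"
  using Cauchy_Schwarz_ineq2[of "outer a b" P]
  by (simp add: inner_outer norm_outer mult.commute)

lemma abs_quad_le: "\<bar>quad P v\<bar> \<le> norm P * (v \<bullet> v)"
  using abs_bilinear_le[of v P v]
  by (simp add: quad_def dot_square_norm power2_eq_square)

lemma inner_transpose_mult:
  fixes x :: "real^'n" and y :: "real^'m"
  shows "x \<bullet> (transpose A *v y) = (A *v x) \<bullet> y"
  using dot_lmul_matrix[of y A x] by (simp add: inner_commute)

lemma quad_add [simp]: "quad (P + P') v = quad P v + quad P' v"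
  and quad_diff [simp]: "quad (P - P') v = quad P v - quad P' v"
  and quad_scaleR [simp]: "quad (c *\<^sub>R P) v = c * quad P v"
  and quad_mat_1 [simp]: "quad (mat 1) v = v \<bullet> v"
  and quad_0 [simp]: "quad 0 v = 0"
  and quad_0_right [simp]: "quad P 0 = 0"
  by (simp_all add: quad_def algebra_simps scaleR_matrix_vector_assoc[symmetric])

lemma quad_congr [simp]: "quad (transpose F ** P ** F) v = quad P (F *v v)"
  by (simp only: quad_def inner_transpose_mult matrix_vector_mul_assoc[symmetric])

lemma quad_scaleR_right: "quad P (c *\<^sub>R v) = c\<^sup>2 * quad P v"
  by (simp add: quad_def matrix_vector_mult_scaleR power2_eq_square)

lemma symmetric_inner:
  fixes x :: "real^'n"
  shows "transpose P = P \<Longrightarrow> x \<bullet> (P *v y) = y \<bullet> (P *v x)"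
  using inner_transpose_mult[of x P y] by (simp add: inner_commute)

lemma quad_add_right:
  "transpose P = P \<Longrightarrow> quad P (x + y) = quad P x + 2 * (x \<bullet> (P *v y)) + quad P y"
  by (simp add: quad_def algebra_simps inner_add_left inner_add_right symmetric_inner)

lemma quad_polarization:
  "transpose P = P \<Longrightarrow> x \<bullet> (P *v y) = (quad P (x + y) - quad P x - quad P y) / 2"
  by (simp add: quad_add_right)

text \<open>Polarisation at basis vectors writes each entry through three values of the form, so
  identities and limits known pointwise for \<open>quad\<close> pass to the matrix itself.\<close>

lemma symmetric_component:
  assumes "transpose P = P"
  shows "P $ i $ j = (quad P (axis i 1 + axis j 1) - quad P (axis i 1) - quad P (axis j 1)) / 2"
proof -
  have "P $ i $ j = axis i 1 \<bullet> (P *v axis j 1)"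
    by (simp add: matrix_vector_mult_basis column_def inner_axis')
  then show ?thesis by (simp only: quad_polarization[OF assms])
qed

lemma symmetric_quad_eqI:
  assumes "transpose P = P" "transpose P' = P'" "\<And>v. quad P v = quad P' v"
  shows "P = P'"
proof -
  have "P $ i $ j = P' $ i $ j" for i j
    by (simp add: symmetric_component assms)
  then show ?thesis by (simp add: vec_eq_iff)
qed

lemma tendsto_matrixI:
  fixes P :: "nat \<Rightarrow> real^'n^'m"
  assumes "\<And>i j. (\<lambda>k. P k $ i $ j) \<longlonglongrightarrow> L $ i $ j"
  shows "P \<longlonglongrightarrow> L"
  by (intro vec_tendstoI assms)

lemma symmetric_tendsto_0:
  assumes "\<And>k. transpose (P k) = P k" "\<And>v. (\<lambda>k. quad (P k) v) \<longlonglongrightarrow> 0"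
  shows "P \<longlonglongrightarrow> 0"
proof (rule tendsto_matrixI)
  fix i j
  have "(\<lambda>k. (quad (P k) (axis i 1 + axis j 1) - quad (P k) (axis i 1) - quad (P k) (axis j 1)) / 2)
          \<longlonglongrightarrow> (0 - 0 - 0) / 2"
    by (intro tendsto_intros assms) simp
  then show "(\<lambda>k. P k $ i $ j) \<longlonglongrightarrow> 0 $ i $ j"
    by (simp add: symmetric_component[OF assms(1)])
qed

lemma tendsto_transpose: "P \<longlonglongrightarrow> L \<Longrightarrow> (\<lambda>k. transpose (P k)) \<longlonglongrightarrow> transpose L"
  for P :: "nat \<Rightarrow> real^'n^'m"
  unfolding transpose_def by (rule tendsto_matrixI) (simp, intro tendsto_vec_nth, assumption)

lemma symmetric_convergent:
  assumes sym: "\<And>k. transpose (P k) = P k" and conv: "\<And>v. convergent (\<lambda>k. quad (P k) v)"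
  obtains L where "P \<longlonglongrightarrow> L" "transpose L = L"
proof -
  have "convergent (\<lambda>k. P k $ i $ j)" for i j
  proof -
    have "convergent (\<lambda>k. (quad (P k) (axis i 1 + axis j 1) - quad (P k) (axis i 1) - quad (P k) (axis j 1)) / 2)"
      unfolding divide_inverse by (intro convergent_mult convergent_diff convergent_const conv)
    then show ?thesis by (simp only: symmetric_component[OF sym])
  qed
  then obtain l where l: "(\<lambda>k. P k $ i $ j) \<longlonglongrightarrow> l i j" for i j
    unfolding convergent_def by metis
  define L where "L = (\<chi> i j. l i j)"
  have L: "P \<longlonglongrightarrow> L" by (rule tendsto_matrixI) (simp add: L_def l)
  moreover have "transpose L = L"
    using LIMSEQ_unique[OF tendsto_transpose[OF L]] L by (simp add: sym)
  ultimately show thesis by (rule that)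
qed

lemma tendsto_bilinear:
  fixes P :: "nat \<Rightarrow> real^'n^'m"
  assumes "P \<longlonglongrightarrow> L" "x \<longlonglongrightarrow> a"
  shows "(\<lambda>k. P k *v x k) \<longlonglongrightarrow> L *v a"
  unfolding matrix_vector_mult_def
  by (rule vec_tendstoI) (simp, intro tendsto_sum tendsto_mult tendsto_vec_nth assms)

lemma tendsto_quad:
  assumes "P \<longlonglongrightarrow> L" "x \<longlonglongrightarrow> a"
  shows "(\<lambda>k. quad (P k) (x k)) \<longlonglongrightarrow> quad L a"
  unfolding quad_def by (intro tendsto_inner tendsto_bilinear assms)

text \<open>The form attains a positive minimum on the compact unit sphere, and homogeneity extends
  the bound to all vectors.\<close>

lemma pos_def_imp_lower_bound:
  fixes R :: "real^'n^'n"
  assumes "pos_def R"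
  obtains r where "r > 0" "\<And>v. r * (v \<bullet> v) \<le> quad R v"
proof -
  have cont: "continuous_on (sphere 0 1) (quad R)"
    unfolding quad_def
    by (intro continuous_intros)
  have ne: "sphere 0 1 \<noteq> ({} :: (real^'n) set)"
    by simp
  obtain w where w: "w \<in> sphere 0 1" "\<And>v. v \<in> sphere 0 1 \<Longrightarrow> quad R w \<le> quad R v"
    using continuous_attains_inf[OF compact_sphere ne cont] by blast
  have "w \<noteq> 0" using w(1) by auto
  then have "quad R w > 0" using assms by (simp add: pos_def_def quad_def)
  moreover have "quad R w * (v \<bullet> v) \<le> quad R v" for v
  proof (cases "v = 0")
    case False
    have "quad R w \<le> quad R ((1 / norm v) *\<^sub>R v)"
      using False by (intro w(2)) simp
    then show ?thesis using False
      unfolding quad_scaleR_right by (simp add: field_simps power2_norm_eq_inner)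
  qed simp
  ultimately show thesis by (rule that)
qed

lemma pos_def_matrix_inv:
  assumes "pos_def U"
  shows "U ** matrix_inv U = mat 1" "matrix_inv U ** U = mat 1"
proof -
  have "U *v x = 0 \<Longrightarrow> x = 0" for x
    using assms unfolding pos_def_def by (metis inner_zero_right less_irrefl)
  then have "\<exists>V. U ** V = mat 1 \<and> V ** U = mat 1"
    by (metis invertible_left_inverse matrix_left_invertible_ker invertible_def)
  then show "U ** matrix_inv U = mat 1" "matrix_inv U ** U = mat 1"
    unfolding matrix_inv_def by (metis (mono_tags, lifting) someI_ex)+
qed

lemma transpose_add: "transpose (A + B) = transpose A + transpose B"
  and transpose_diff: "transpose (A - B) = transpose A - transpose B"
  for A B :: "real^'n^'m"
  by (simp_all add: transpose_def vec_eq_iff)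

lemma transpose_congr: "transpose P = P \<Longrightarrow> transpose (transpose F ** P ** F) = transpose F ** P ** F"
  for F :: "real^'n^'m"
  by (simp add: matrix_transpose_mul matrix_mul_assoc)

lemma pos_semidef_quad: "pos_semidef P \<longleftrightarrow> transpose P = P \<and> (\<forall>v. 0 \<le> quad P v)"
  by (simp add: pos_semidef_def quad_def)

text \<open>Moving from \<open>v\<close> against \<open>w = Q *v v\<close> by the factor
  \<open>1 / norm Q\<close> lowers the form by at least \<open>(w \<bullet> w) / norm Q\<close>, and
  the form cannot become negative.\<close>

lemma pos_semidef_quad_bound_image:
  fixes Q :: "real^'n^'n"
  assumes "pos_semidef Q"
  shows "(Q *v v) \<bullet> (Q *v v) \<le> norm Q * quad Q v"
proof -
  have sym: "transpose Q = Q" and nn: "\<And>v. 0 \<le> quad Q v" using assms by (auto simp: pos_semidef_quad)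
  define w where "w = Q *v v"
  have ww: "w \<bullet> w = v \<bullet> (Q *v w)"
    using symmetric_inner[OF sym, of w v] by (simp add: w_def)
  have q: "quad Q w \<le> norm Q * (w \<bullet> w)" using abs_quad_le[of Q w] by simp
  show ?thesis
  proof (cases "Q = 0")
    case False
    define t where "t = 1 / norm Q"
    have t: "t > 0" "t * norm Q = 1" using False by (auto simp: t_def)
    have "0 \<le> quad Q (v + (- t) *\<^sub>R w)" by (rule nn)
    also have "\<dots> = quad Q v - 2 * t * (w \<bullet> w) + t\<^sup>2 * quad Q w"
      by (simp only: quad_add_right[OF sym] quad_scaleR_right matrix_vector_mult_scaleR inner_scaleR_right ww) simp
    also have "\<dots> \<le> quad Q v - 2 * t * (w \<bullet> w) + t\<^sup>2 * (norm Q * (w \<bullet> w))"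
      using q by (simp add: mult_left_mono)
    also have "t\<^sup>2 * (norm Q * (w \<bullet> w)) = t * (t * norm Q) * (w \<bullet> w)"
      by (simp add: power2_eq_square)
    finally have "t * (w \<bullet> w) \<le> quad Q v" by (simp add: t)
    then have "norm Q * (t * (w \<bullet> w)) \<le> norm Q * quad Q v" by (intro mult_left_mono) auto
    then show ?thesis using t by (simp add: w_def mult.assoc[symmetric] mult.commute)
  qed simp
qed

text \<open>With such a \<open>G\<close>, the matrix \<open>mat 1 - G ** Q\<close> projects onto the
  kernel of \<open>Q\<close>, which is where detectability gives information.\<close>

lemma matrix_generalized_inverse:
  fixes Q :: "real^'n^'m"
  obtains G :: "real^'m^'n" where "\<And>v. Q *v (G *v (Q *v v)) = Q *v v"
proof -
  obtain g where g: "linear g" "\<forall>v\<in>range ((*v) Q). Q *v (g v) = v"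
    using linear_exists_right_inverse_on[OF matrix_vector_mul_linear subspace_UNIV, of Q] by blast
  show thesis
    by (rule that[of "matrix g"]) (use g in \<open>simp add: matrix_works\<close>)
qed

section \<open>Orbits of positive operators in an order unit cone\<close>

lemma linear_funpow:
  fixes f :: "'a::real_vector \<Rightarrow> 'a"
  shows "linear f \<Longrightarrow> linear (f ^^ n)"
  by (induction n) (auto simp: id_def[symmetric] intro: linear_id linear_compose simp del: id_apply)

text \<open>An order unit with the norm as its constant: a functional in the dual cone is controlled
  by its single value at \<open>e\<close>, which serves as the normalisation.\<close>

locale order_unit_cone =
  fixes K :: "'a::euclidean_space set" and e :: 'a
  assumes unit_in_cone: "e \<in> K"
    and unit_dominates: "norm p *\<^sub>R e - p \<in> K"
begin

definition dual_cone :: "'a set" where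
  "dual_cone = {z. \<forall>p\<in>K. 0 \<le> z \<bullet> p}"

lemma dual_coneD: "z \<in> dual_cone \<Longrightarrow> p \<in> K \<Longrightarrow> 0 \<le> z \<bullet> p"
  by (simp add: dual_cone_def)

lemma inner_le_unit: "z \<in> dual_cone \<Longrightarrow> z \<bullet> p \<le> norm p * (z \<bullet> e)"
  using dual_coneD[OF _ unit_dominates[of p], of z] by (simp add: inner_diff_right)

text \<open>The inner product identifies functionals with points, so the unit may be compared with
  \<open>z\<close> itself. Compactness of normalised functionals rests on this bound.\<close>

lemma norm_le_unit:
  assumes "z \<in> dual_cone"
  shows "norm z \<le> z \<bullet> e"
proof (cases "z = 0")
  case False
  have "norm z * norm z \<le> norm z * (z \<bullet> e)"
    using inner_le_unit[OF assms, of z] by (simp add: dot_square_norm power2_eq_square)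
  then show ?thesis using False by simp
qed simp

text \<open>If the orbit sum diverged, a limit point \<open>Z\<close> of the normalised partial sums would satisfy
  \<open>Z \<bullet> \<Phi> p \<ge> Z \<bullet> p\<close> on the cone, so its orbit could not decay, while \<open>c\<close> would vanish along that
  orbit because \<open>c\<close> telescopes against the Lyapunov element \<open>V\<close>. This replaces a Perron-Frobenius
  argument.\<close>

lemma summable_orbit:
  assumes lin: "linear \<Phi>" and pos: "\<And>p. p \<in> K \<Longrightarrow> \<Phi> p \<in> K"
    and c: "c \<in> K" and V: "V \<in> K" and lyap: "V = c + \<Phi> V"
    and detect: "\<And>Z. Z \<in> dual_cone \<Longrightarrow> (\<And>j. Z \<bullet> (\<Phi> ^^ j) c = 0) \<Longrightarrow> (\<lambda>j. Z \<bullet> (\<Phi> ^^ j) e) \<longlonglongrightarrow> 0"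
    and z: "z \<in> dual_cone"
  shows "summable (\<lambda>k. z \<bullet> (\<Phi> ^^ k) e)"
proof (rule ccontr)
  assume not_summable: "\<not> summable (\<lambda>k. z \<bullet> (\<Phi> ^^ k) e)"
  have posk: "p \<in> K \<Longrightarrow> (\<Phi> ^^ k) p \<in> K" for p k
    by (induction k) (auto intro: pos)
  define a where "a k = z \<bullet> (\<Phi> ^^ k) e" for k
  have a_nonneg: "0 \<le> a k" for k
    unfolding a_def by (intro dual_coneD z posk unit_in_cone)
  define s where "s N = (\<Sum>k<N. a k)" for N
  have s_mono: "s m \<le> s n" if "m \<le> n" for m n
    unfolding s_def using that by (intro sum_mono2 a_nonneg) auto
  have s_top: "filterlim s at_top sequentially"
  proof -
    have "\<exists>n. B \<le> s n" for B
    proof (rule ccontr)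
      assume "\<nexists>n. B \<le> s n"
      then have "s n \<le> B" for n by (meson linear le_cases)
      then have "summable a"
        by (intro summableI_nonneg_bounded[of a B] a_nonneg) (simp add: s_def)
      then show False using not_summable by (simp add: a_def[abs_def])
    qed
    then show ?thesis
      unfolding filterlim_at_top eventually_sequentially by (meson s_mono order_trans)
  qed
  define T where "T = adjoint \<Phi>"
  have T: "T x \<bullet> p = x \<bullet> \<Phi> p" for x p
    using adjoint_works[OF lin, of p x] by (simp add: T_def inner_commute)
  have Tk: "(T ^^ k) x \<bullet> p = x \<bullet> (\<Phi> ^^ k) p" for k x p
    by (induction k arbitrary: p) (simp_all add: T funpow_swap1[symmetric])
  define Z where "Z N = inverse (s N) *\<^sub>R (\<Sum>k<N. (T ^^ k) z)" for N
  have Z_inner: "Z N \<bullet> p = inverse (s N) * (\<Sum>k<N. z \<bullet> (\<Phi> ^^ k) p)" for N p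
    by (simp add: Z_def inner_sum_left Tk)
  have s_nonneg: "0 \<le> s N" for N by (simp add: s_def sum_nonneg a_nonneg)
  have Z_dual: "Z N \<in> dual_cone" for N
    by (simp add: dual_cone_def Z_inner s_nonneg sum_nonneg dual_coneD[OF z] posk)
  have Z_unit: "Z N \<bullet> e = inverse (s N) * s N" for N
    by (simp add: Z_inner s_def a_def)
  \<comment> \<open>If \<open>s N = 0\<close>, the convention \<open>inverse 0 = 0\<close> makes
    \<open>Z N\<close> zero, so the bound holds for every index.\<close>
  have "norm (Z N) \<le> 1" for N
    using norm_le_unit[OF Z_dual, of N] by (simp add: Z_unit split: if_splits) (cases "s N = 0"; simp)
  then have "\<forall>N. Z N \<in> cball 0 1" by simp
  then obtain Y r where r: "strict_mono r" and Y: "(Z \<circ> r) \<longlonglongrightarrow> Y"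
    using compact_cball[of "0::'a" 1] unfolding compact_eq_seq_compact_metric seq_compact_def by blast
  have lim: "(\<lambda>n. Z (r n) \<bullet> p) \<longlonglongrightarrow> Y \<bullet> p" for p
    using Y unfolding comp_def by (intro tendsto_intros)
  have inv_s: "(\<lambda>n. inverse (s (r n))) \<longlonglongrightarrow> 0"
    by (rule tendsto_inverse_0_at_top[OF filterlim_compose[OF s_top filterlim_subseq[OF r]]])
  have s_pos: "eventually (\<lambda>n. s (r n) > 0) sequentially"
    using filterlim_compose[OF s_top filterlim_subseq[OF r]] by (simp add: filterlim_at_top_dense)
  have Y_dual: "Y \<in> dual_cone"
    unfolding dual_cone_def by (auto intro!: LIMSEQ_le_const[OF lim] dual_coneD[OF Z_dual])
  have Y_unit: "Y \<bullet> e = 1"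
  proof (rule LIMSEQ_unique[OF lim])
    show "(\<lambda>n. Z (r n) \<bullet> e) \<longlonglongrightarrow> 1"
      by (rule tendsto_eventually) (use s_pos in eventually_elim, simp add: Z_unit)
  qed
  have Y_c: "Y \<bullet> (\<Phi> ^^ j) c = 0" for j
  proof (rule LIMSEQ_unique[OF lim], rule tendsto_sandwich)
    show "\<forall>\<^sub>F n in sequentially. 0 \<le> Z (r n) \<bullet> (\<Phi> ^^ j) c"
      by (simp add: dual_coneD[OF Z_dual] posk c)
    have "(\<Sum>k<N. z \<bullet> (\<Phi> ^^ k) c) + z \<bullet> (\<Phi> ^^ N) V = z \<bullet> V" for N
    proof (induction N)
      case (Suc N)
      have "(\<Phi> ^^ N) V = (\<Phi> ^^ N) c + (\<Phi> ^^ Suc N) V"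
        unfolding funpow_Suc_right o_apply linear_add[OF linear_funpow[OF lin], symmetric]
        using lyap by (rule arg_cong)
      then have "z \<bullet> (\<Phi> ^^ N) V = z \<bullet> (\<Phi> ^^ N) c + z \<bullet> (\<Phi> ^^ Suc N) V"
        by (simp only: inner_add_right)
      then show ?case using Suc by simp
    qed simp
    then have tele: "(\<Sum>k<N. z \<bullet> (\<Phi> ^^ k) c) \<le> z \<bullet> V" for N
      using dual_coneD[OF z posk[OF V, of N]] by (metis add_increasing2 order_refl add.commute le_add_same_cancel1)
    \<comment> \<open>Shifting by \<open>j\<close> is harmless: the shifted sum is part of a longer
      initial segment, and the telescoped bound is the same for every length.\<close>
    have "(\<Sum>k<N. z \<bullet> (\<Phi> ^^ k) ((\<Phi> ^^ j) c)) \<le> z \<bullet> V" for N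
    proof -
      have "(\<Sum>k<N. z \<bullet> (\<Phi> ^^ k) ((\<Phi> ^^ j) c)) = (\<Sum>k\<in>{j..<N+j}. z \<bullet> (\<Phi> ^^ k) c)"
        using sum.shift_bounds_nat_ivl[of "\<lambda>k. z \<bullet> (\<Phi> ^^ k) c" 0 j N]
        by (simp add: funpow_add atLeast0LessThan)
      also have "\<dots> \<le> (\<Sum>k<N+j. z \<bullet> (\<Phi> ^^ k) c)"
        by (intro sum_mono2) (auto intro!: dual_coneD z posk c)
      finally show ?thesis using tele[of "N + j"] by simp
    qed
    then show "\<forall>\<^sub>F n in sequentially. Z (r n) \<bullet> (\<Phi> ^^ j) c \<le> inverse (s (r n)) * (z \<bullet> V)"
      unfolding Z_inner by (auto intro!: mult_left_mono always_eventually simp: s_nonneg)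
    show "(\<lambda>n. inverse (s (r n)) * (z \<bullet> V)) \<longlonglongrightarrow> 0"
      using tendsto_mult[OF inv_s tendsto_const, of "z \<bullet> V"] by simp
  qed simp
  \<comment> \<open>Applying \<open>\<Phi>\<close> shifts the orbit sum by one index. Only the first
    term \<open>z \<bullet> p\<close> is lost, and it vanishes after division by the divergent
    \<open>s\<close>; the new last term is nonnegative.\<close>
  have Y_expand: "Y \<bullet> p \<le> Y \<bullet> \<Phi> p" if p: "p \<in> K" for p
  proof (rule LIMSEQ_le)
    show "(\<lambda>n. Z (r n) \<bullet> p - inverse (s (r n)) * (z \<bullet> p)) \<longlonglongrightarrow> Y \<bullet> p"
      using tendsto_diff[OF lim tendsto_mult[OF inv_s tendsto_const], of p "z \<bullet> p"] by simp
    show "(\<lambda>n. Z (r n) \<bullet> \<Phi> p) \<longlonglongrightarrow> Y \<bullet> \<Phi> p" by (rule lim)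
    have "(\<Sum>k<N. z \<bullet> (\<Phi> ^^ k) p) - z \<bullet> p \<le> (\<Sum>k<N. z \<bullet> (\<Phi> ^^ k) (\<Phi> p))" for N
    proof -
      have "(\<Sum>k<N. z \<bullet> (\<Phi> ^^ k) p) \<le> (\<Sum>k<Suc N. z \<bullet> (\<Phi> ^^ k) p)"
        by (simp add: dual_coneD z posk p)
      also have "\<dots> = z \<bullet> p + (\<Sum>k<N. z \<bullet> (\<Phi> ^^ k) (\<Phi> p))"
        by (subst sum.lessThan_Suc_shift) (simp add: funpow_swap1)
      finally show ?thesis by simp
    qed
    then have "Z N \<bullet> p - inverse (s N) * (z \<bullet> p) \<le> Z N \<bullet> \<Phi> p" for N
      unfolding Z_inner right_diff_distrib[symmetric] by (intro mult_left_mono) (simp_all add: s_nonneg)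
    then show "\<exists>N. \<forall>n\<ge>N. Z (r n) \<bullet> p - inverse (s (r n)) * (z \<bullet> p) \<le> Z (r n) \<bullet> \<Phi> p"
      by blast
  qed
  have "1 \<le> Y \<bullet> (\<Phi> ^^ j) e" for j
  proof (induction j)
    case (Suc j)
    then show ?case using Y_expand[OF posk[OF unit_in_cone, of j]] by simp
  qed (simp add: Y_unit)
  with LIMSEQ_le_const[OF detect[OF Y_dual Y_c]] have "(1::real) \<le> 0" by blast
  then show False by simp
qed

text \<open>\<open>c\<close> lies below \<open>norm c\<close> times the unit, and a positive map
  keeps this order along the orbit. This caps the cost of a stable feedback over every finite
  horizon.\<close>

lemma orbit_sum_bounded:
  assumes "\<And>p. p \<in> K \<Longrightarrow> \<Phi> p \<in> K" and lin: "linear \<Phi>" and "z \<in> dual_cone"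
    and summable: "summable (\<lambda>k. z \<bullet> (\<Phi> ^^ k) e)"
  shows "(\<Sum>k<N. z \<bullet> (\<Phi> ^^ k) c) \<le> norm c * (\<Sum>k. z \<bullet> (\<Phi> ^^ k) e)"
proof -
  have posk: "p \<in> K \<Longrightarrow> (\<Phi> ^^ k) p \<in> K" for p k
    by (induction k) (auto intro: assms)
  have "z \<bullet> (\<Phi> ^^ k) c \<le> norm c * (z \<bullet> (\<Phi> ^^ k) e)" for k
    using dual_coneD[OF \<open>z \<in> dual_cone\<close> posk[OF unit_dominates[of c], of k]] linear_funpow[OF lin, of k]
    by (simp add: linear_diff linear_scale inner_diff_right)
  then have "(\<Sum>k<N. z \<bullet> (\<Phi> ^^ k) c) \<le> norm c * (\<Sum>k<N. z \<bullet> (\<Phi> ^^ k) e)"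
    by (simp add: sum_distrib_left sum_mono)
  also have "\<dots> \<le> norm c * (\<Sum>k. z \<bullet> (\<Phi> ^^ k) e)"
    by (intro mult_left_mono sum_le_suminf summable) (auto intro!: dual_coneD assms posk unit_in_cone)
  finally show ?thesis .
qed

end

section \<open>Riccati maps\<close>

lemma matrix_add_rdistrib: "(X + Y) ** Z = X ** Z + Y ** Z"
  for X Y :: "real^'n^'m"
  by (simp add: matrix_matrix_mult_def vec_eq_iff distrib_right sum.distrib)

lemma matrix_vector_mult_minus: "(- X) *v v = - (X *v v)"
  and matrix_vector_mult_minus_right: "X *v (- v) = - (X *v v)"
  for X :: "real^'n^'m"
  by (simp_all add: matrix_vector_mult_def vec_eq_iff sum_negf)

text \<open>Symmetry is tracked separately by \<open>symmetric_pair\<close>, so that the order-unit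
  inequality holds on the whole product space. Antisymmetric pairs lie in the cone with both signs,
  hence every dual functional vanishes on them.\<close>

definition nonneg_forms :: "((real^'n^'n) \<times> (real^'n^'n)) set" where
  "nonneg_forms = {p. \<forall>v. 0 \<le> quad (fst p) v \<and> 0 \<le> quad (snd p) v}"

definition unit_forms :: "(real^'n^'n) \<times> (real^'n^'n)" where
  "unit_forms = (mat 1, mat 1)"

interpretation forms: order_unit_cone "nonneg_forms :: ((real^'n^'n) \<times> (real^'n^'n)) set" unit_forms
proof
  show "unit_forms \<in> (nonneg_forms :: ((real^'n^'n) \<times> (real^'n^'n)) set)"
    by (simp add: nonneg_forms_def unit_forms_def)
  fix p :: "(real^'n^'n) \<times> (real^'n^'n)"
  have "quad (fst p) v \<le> norm p * (v \<bullet> v) \<and> quad (snd p) v \<le> norm p * (v \<bullet> v)" for v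
    using abs_quad_le[of "fst p" v] abs_quad_le[of "snd p" v]
      mult_right_mono[OF norm_fst_le[of "fst p" "snd p"] inner_ge_zero[of v]]
      mult_right_mono[OF norm_snd_le[of "snd p" "fst p"] inner_ge_zero[of v]]
    unfolding prod.collapse by (intro conjI; linarith)
  then show "norm p *\<^sub>R unit_forms - p \<in> nonneg_forms"
    by (simp add: nonneg_forms_def unit_forms_def)
qed

text \<open>Through these functionals, statements about the whole dual cone specialise to the value
  of one form at one vector.\<close>

lemma outer_dual:
  "(outer v v, 0) \<in> forms.dual_cone" "(0, outer v v) \<in> forms.dual_cone"
  unfolding forms.dual_cone_def
  by (simp_all add: nonneg_forms_def inner_outer inner_prod_def quad_def)

lemma inner_outer_fst: "(outer v v, 0) \<bullet> p = quad (fst p) v"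
  and inner_outer_snd: "(0, outer v v) \<bullet> p = quad (snd p) v"
  by (simp_all add: inner_outer inner_prod_def quad_def)

text \<open>The adjoint of the second-moment dynamics: \<open>F\<close>, \<open>G\<close> drive the
  deviation and \<open>Fh\<close>, \<open>Gh\<close> the mean. The noise has mean zero, so whatever
  it multiplies, the mean included, ends up in the deviation; this is why \<open>fst p\<close>
  weights the diffusion term of both components.\<close>

definition lyap ::
    "real \<Rightarrow> real^'n^'n \<Rightarrow> real^'n^'n \<Rightarrow> real^'n^'n \<Rightarrow> real^'n^'n \<Rightarrow>
     (real^'n^'n) \<times> (real^'n^'n) \<Rightarrow> (real^'n^'n) \<times> (real^'n^'n)" where
  "lyap \<sigma> F G Fh Gh p =
     (transpose F ** fst p ** F + \<sigma>\<^sup>2 *\<^sub>R (transpose G ** fst p ** G),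
      transpose Fh ** snd p ** Fh + \<sigma>\<^sup>2 *\<^sub>R (transpose Gh ** fst p ** Gh))"

lemma quad_lyap:
  "quad (fst (lyap \<sigma> F G Fh Gh p)) v = quad (fst p) (F *v v) + \<sigma>\<^sup>2 * quad (fst p) (G *v v)"
  "quad (snd (lyap \<sigma> F G Fh Gh p)) v = quad (snd p) (Fh *v v) + \<sigma>\<^sup>2 * quad (fst p) (Gh *v v)"
  by (simp_all add: lyap_def)

lemma matrix_scaleR_mult: "(k *\<^sub>R X) ** Y = k *\<^sub>R (X ** Y)" "X ** (k *\<^sub>R Y) = k *\<^sub>R (X ** Y)"
  for X :: "real^'n^'m"
  by (simp_all add: scalar_matrix_assoc matrix_scalar_ac)

lemma linear_lyap: "linear (lyap \<sigma> F G Fh Gh)"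
  by (rule linearI)
    (simp_all add: lyap_def matrix_add_ldistrib matrix_add_rdistrib matrix_scaleR_mult algebra_simps)

lemma lyap_nonneg: "p \<in> nonneg_forms \<Longrightarrow> lyap \<sigma> F G Fh Gh p \<in> nonneg_forms"
  by (simp add: nonneg_forms_def quad_lyap)

definition symmetric_pair :: "(real^'n^'n) \<times> (real^'n^'n) \<Rightarrow> bool" where
  "symmetric_pair p \<longleftrightarrow> transpose (fst p) = fst p \<and> transpose (snd p) = snd p"

lemma symmetric_lyap: "symmetric_pair p \<Longrightarrow> symmetric_pair (lyap \<sigma> F G Fh Gh p)"
  by (simp add: symmetric_pair_def lyap_def transpose_add transpose_scalar transpose_congr)

lemma symmetric_lyap_funpow: "symmetric_pair p \<Longrightarrow> symmetric_pair ((lyap \<sigma> F G Fh Gh ^^ k) p)"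
  by (induction k) (simp_all add: symmetric_lyap)

lemma lyap_funpow_nonneg: "p \<in> nonneg_forms \<Longrightarrow> (lyap \<sigma> F G Fh Gh ^^ k) p \<in> nonneg_forms"
  by (induction k) (simp_all add: lyap_nonneg)

lemma symmetric_unit: "symmetric_pair unit_forms"
  by (simp add: symmetric_pair_def unit_forms_def)

definition psd_pair :: "(real^'n^'n) \<times> (real^'n^'n) \<Rightarrow> bool" where
  "psd_pair p \<longleftrightarrow> symmetric_pair p \<and> p \<in> nonneg_forms"

lemma psd_pair_iff: "psd_pair p \<longleftrightarrow> pos_semidef (fst p) \<and> pos_semidef (snd p)"
  by (auto simp: psd_pair_def symmetric_pair_def nonneg_forms_def pos_semidef_quad)

text \<open>Both Riccati equations are instances of one map, in which \<open>P1\<close> weights the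
  drift and \<open>P2\<close> the diffusion: the deviation takes \<open>P1 = P2 = P\<close>, the
  mean takes \<open>P1 = P + Pb\<close> and \<open>P2 = P\<close> with summed coefficient
  matrices.\<close>

locale riccati_map =
  fixes \<sigma> :: real and A C Q :: "real^'n^'n" and B D :: "real^'m^'n" and R :: "real^'m^'m"
  assumes R: "pos_def R" and Q: "pos_semidef Q"
begin

definition U :: "real^'n^'n \<Rightarrow> real^'n^'n \<Rightarrow> real^'m^'m" where
  "U P1 P2 = R + transpose B ** P1 ** B + \<sigma>\<^sup>2 *\<^sub>R (transpose D ** P2 ** D)"

definition N :: "real^'n^'n \<Rightarrow> real^'n^'n \<Rightarrow> real^'n^'m" where
  "N P1 P2 = transpose B ** P1 ** A + \<sigma>\<^sup>2 *\<^sub>R (transpose D ** P2 ** C)"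

definition gain :: "real^'n^'n \<Rightarrow> real^'n^'n \<Rightarrow> real^'n^'m" where
  "gain P1 P2 = - (matrix_inv (U P1 P2) ** N P1 P2)"

definition ric :: "real^'n^'n \<Rightarrow> real^'n^'n \<Rightarrow> real^'n^'n" where
  "ric P1 P2 = Q + transpose A ** P1 ** A + \<sigma>\<^sup>2 *\<^sub>R (transpose C ** P2 ** C)
     - transpose (N P1 P2) ** matrix_inv (U P1 P2) ** N P1 P2"

text \<open>The Bellman expression: the cost of applying \<open>u\<close> now plus the value of the
  next state. For positive semidefinite forms \<open>ric\<close> is its minimum over
  \<open>u\<close>.\<close>

definition stage :: "real^'n^'n \<Rightarrow> real^'n^'n \<Rightarrow> real^'n \<Rightarrow> real^'m \<Rightarrow> real" where
  "stage P1 P2 v u = quad Q v + quad R u + quad P1 (A *v v + B *v u) + \<sigma>\<^sup>2 * quad P2 (C *v v + D *v u)"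

lemma R_sym: "transpose R = R" and R_nonneg: "0 \<le> quad R u" and Q_sym: "transpose Q = Q" and Q_nonneg: "0 \<le> quad Q v"
  using R Q by (auto simp: pos_def_def pos_semidef_quad quad_def) (cases "u = 0"; simp add: less_imp_le)

context
  fixes P1 P2 :: "real^'n^'n"
  assumes P1: "pos_semidef P1" and P2: "pos_semidef P2"
begin

lemma forms_sym: "transpose P1 = P1" "transpose P2 = P2"
  and forms_nonneg: "0 \<le> quad P1 v" "0 \<le> quad P2 v"
  using P1 P2 by (auto simp: pos_semidef_quad)

lemma U_pos_def: "pos_def (U P1 P2)"
proof -
  have "0 < quad (U P1 P2) v" if "v \<noteq> 0" for v
    using R that forms_nonneg
    by (auto simp: U_def pos_def_def quad_def[of R] intro!: add_pos_nonneg)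
  then show ?thesis
    by (simp add: pos_def_def quad_def[symmetric] U_def transpose_add transpose_scalar transpose_congr forms_sym R_sym)
qed

lemma U_sym: "transpose (U P1 P2) = U P1 P2" and U_nonneg: "0 \<le> quad (U P1 P2) u"
  using U_pos_def by (auto simp: pos_def_def quad_def) (cases "u = 0"; simp add: less_imp_le)

lemma U_gain: "U P1 P2 *v (gain P1 P2 *v v) = - (N P1 P2 *v v)"
proof -
  have "U P1 P2 *v (gain P1 P2 *v v) = - ((U P1 P2 ** matrix_inv (U P1 P2)) *v (N P1 P2 *v v))"
    by (simp add: gain_def matrix_vector_mult_minus matrix_vector_mult_minus_right matrix_vector_mul_assoc[symmetric])
  then show ?thesis by (simp add: pos_def_matrix_inv[OF U_pos_def])
qed

text \<open>The gain is the stationary point, \<open>U g = - N v\<close>, so the square around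
  \<open>g\<close> absorbs all terms linear in \<open>u\<close>; the part free of \<open>u\<close>
  is what \<open>ric\<close> collects.\<close>

lemma complete_square:
  "stage P1 P2 v u = quad (ric P1 P2) v + quad (U P1 P2) (u - gain P1 P2 *v v)"
proof -
  define g where "g = gain P1 P2 *v v"
  have Ug: "U P1 P2 *v g = - (N P1 P2 *v v)" by (simp add: g_def U_gain)
  have g: "g = - (matrix_inv (U P1 P2) *v (N P1 P2 *v v))"
    by (simp add: g_def gain_def matrix_vector_mult_minus matrix_vector_mul_assoc)
  have "quad (U P1 P2) g = quad (matrix_inv (U P1 P2)) (N P1 P2 *v v)"
    unfolding quad_def Ug by (simp add: g inner_commute)
  moreover have "quad (U P1 P2) (u - g) = quad (U P1 P2) u + 2 * (u \<bullet> (N P1 P2 *v v)) + quad (U P1 P2) g"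
    using quad_add_right[OF U_sym, of u "- g"] Ug
    by (simp add: quad_def matrix_vector_mult_minus_right)
  moreover have "u \<bullet> (N P1 P2 *v v) = (B *v u) \<bullet> (P1 *v (A *v v)) + \<sigma>\<^sup>2 * ((D *v u) \<bullet> (P2 *v (C *v v)))"
    by (simp add: N_def matrix_vector_mult_add_rdistrib inner_add_right scaleR_matrix_vector_assoc[symmetric]
        matrix_vector_mul_assoc[symmetric] inner_transpose_mult del: transpose_matrix_vector)
  moreover have "quad P1 (A *v v + B *v u) = quad P1 (A *v v) + 2 * ((B *v u) \<bullet> (P1 *v (A *v v))) + quad P1 (B *v u)"
    and "quad P2 (C *v v + D *v u) = quad P2 (C *v v) + 2 * ((D *v u) \<bullet> (P2 *v (C *v v))) + quad P2 (D *v u)"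
    by (simp_all add: quad_add_right forms_sym symmetric_inner[OF forms_sym(1), of "A *v v"] symmetric_inner[OF forms_sym(2), of "C *v v"])
  moreover have "quad (U P1 P2) u = quad R u + quad P1 (B *v u) + \<sigma>\<^sup>2 * quad P2 (D *v u)"
    by (simp add: U_def)
  moreover have "quad (ric P1 P2) v = quad Q v + quad P1 (A *v v) + \<sigma>\<^sup>2 * quad P2 (C *v v) - quad (matrix_inv (U P1 P2)) (N P1 P2 *v v)"
    by (simp add: ric_def)
  ultimately show ?thesis
    unfolding stage_def g_def[symmetric] by (simp add: algebra_simps)
qed

lemma ric_le_stage: "quad (ric P1 P2) v \<le> stage P1 P2 v u"
  by (simp add: complete_square U_nonneg)

lemma ric_eq_stage: "quad (ric P1 P2) v = stage P1 P2 v (gain P1 P2 *v v)"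
  by (simp add: complete_square)

text \<open>The subtracted term in \<open>ric\<close> hides the sign, but at the minimising control
  the form is a sum of nonnegative stage terms.\<close>

lemma ric_pos_semidef: "pos_semidef (ric P1 P2)"
proof -
  have "transpose (matrix_inv (U P1 P2)) = matrix_inv (U P1 P2)"
  proof -
    have "transpose (matrix_inv (U P1 P2)) ** U P1 P2 = mat 1"
      using pos_def_matrix_inv(1)[OF U_pos_def] matrix_transpose_mul[of "U P1 P2" "matrix_inv (U P1 P2)"]
      by (simp add: U_sym)
    then show ?thesis
      by (metis matrix_mul_assoc matrix_mul_lid matrix_mul_rid pos_def_matrix_inv(1)[OF U_pos_def])
  qed
  then have "transpose (ric P1 P2) = ric P1 P2"
    by (simp add: ric_def transpose_add transpose_diff transpose_scalar transpose_congr forms_sym Q_sym)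
  moreover have "0 \<le> quad (ric P1 P2) v" for v
    by (simp add: ric_eq_stage stage_def forms_nonneg R_nonneg Q_nonneg)
  ultimately show ?thesis by (simp add: pos_semidef_quad)
qed

end

text \<open>The optimal control for the larger forms is an admissible competitor for the smaller
  ones.\<close>

lemma ric_mono:
  assumes "pos_semidef P1" "pos_semidef P2" "pos_semidef P1'" "pos_semidef P2'"
    and "\<And>v. quad P1 v \<le> quad P1' v" "\<And>v. quad P2 v \<le> quad P2' v"
  shows "quad (ric P1 P2) v \<le> quad (ric P1' P2') v"
proof -
  have "quad (ric P1 P2) v \<le> stage P1 P2 v (gain P1' P2' *v v)"
    by (rule ric_le_stage[OF assms(1,2)])
  also have "\<dots> \<le> stage P1' P2' v (gain P1' P2' *v v)"
    unfolding stage_def by (intro add_mono mult_left_mono assms order_refl) simp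
  also have "\<dots> = quad (ric P1' P2') v" by (simp add: ric_eq_stage[OF assms(3,4)])
  finally show ?thesis .
qed

text \<open>The limit is taken in the minimisation rather than in the inverse matrices. One
  inequality tests with a fixed control; the other follows a convergent subsequence of minimisers,
  which stay bounded because \<open>R\<close> is positive definite.\<close>

lemma ric_limit:
  fixes X1 X2 :: "nat \<Rightarrow> real^'n^'n"
  assumes X: "\<And>k. pos_semidef (X1 k)" "\<And>k. pos_semidef (X2 k)" "X1 \<longlonglongrightarrow> P1" "X2 \<longlonglongrightarrow> P2"
    and P: "pos_semidef P1" "pos_semidef P2"
    and lim: "(\<lambda>k. ric (X1 k) (X2 k)) \<longlonglongrightarrow> P"
  shows "P = ric P1 P2"
proof (rule symmetric_quad_eqI)
  have "\<And>k. transpose (ric (X1 k) (X2 k)) = ric (X1 k) (X2 k)"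
    using ric_pos_semidef[OF X(1,2)] by (simp add: pos_semidef_quad)
  then show "transpose P = P"
    using LIMSEQ_unique[OF tendsto_transpose[OF lim]] lim by simp
  show "transpose (ric P1 P2) = ric P1 P2"
    using ric_pos_semidef[OF P] by (simp add: pos_semidef_quad)
  fix v
  have stage_lim: "(\<lambda>k. stage (X1 (r k)) (X2 (r k)) v (u k)) \<longlonglongrightarrow> stage P1 P2 v u'"
    if "strict_mono r" "u \<longlonglongrightarrow> u'" for r :: "nat \<Rightarrow> nat" and u u'
    unfolding stage_def
    using LIMSEQ_subseq_LIMSEQ[OF X(3) that(1)] LIMSEQ_subseq_LIMSEQ[OF X(4) that(1)] that(2)
    by (intro tendsto_add tendsto_mult tendsto_quad tendsto_const tendsto_bilinear) (simp_all add: comp_def)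
  have quad_lim: "(\<lambda>k. quad (ric (X1 k) (X2 k)) v) \<longlonglongrightarrow> quad P v"
    by (intro tendsto_quad lim tendsto_const)
  show "quad P v = quad (ric P1 P2) v"
  proof (rule antisym)
    have "quad P v \<le> stage P1 P2 v (gain P1 P2 *v v)"
      using LIMSEQ_le[OF quad_lim stage_lim[OF strict_mono_id tendsto_const]] ric_le_stage[OF X(1,2)]
      by (simp add: id_def)
    then show "quad P v \<le> quad (ric P1 P2) v" by (simp add: ric_eq_stage[OF P])
    define u where "u k = gain (X1 k) (X2 k) *v v" for k
    obtain r where r: "r > 0" "\<And>v. r * (v \<bullet> v) \<le> quad R v" using pos_def_imp_lower_bound[OF R] by blast
    obtain b where b: "\<And>k. quad (ric (X1 k) (X2 k)) v \<le> b"
      using convergent_imp_Bseq[OF convergentI[OF quad_lim]] unfolding Bseq_def by (metis abs_le_iff real_norm_def)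
    have "quad R (u k) \<le> quad (ric (X1 k) (X2 k)) v" for k
      unfolding ric_eq_stage[OF X(1,2)] stage_def u_def
      using X(1,2) by (simp add: pos_semidef_quad Q_nonneg)
    then have "r * (u k \<bullet> u k) \<le> b" for k by (meson r(2) b order_trans)
    then have "(norm (u k))\<^sup>2 \<le> b / r" for k using r(1) by (simp add: field_simps power2_norm_eq_inner)
    then have "u k \<in> cball 0 (sqrt (b / r))" for k by (simp add: real_le_rsqrt)
    then obtain u' s where s: "strict_mono s" "(u \<circ> s) \<longlonglongrightarrow> u'"
      using compact_cball[of "0::real^'m" "sqrt (b / r)"] unfolding compact_eq_seq_compact_metric seq_compact_def by blast
    have "(\<lambda>k. stage (X1 (s k)) (X2 (s k)) v ((u \<circ> s) k)) \<longlonglongrightarrow> stage P1 P2 v u'"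
      by (rule stage_lim[OF s])
    moreover have "(\<lambda>k. stage (X1 (s k)) (X2 (s k)) v ((u \<circ> s) k)) \<longlonglongrightarrow> quad P v"
      using LIMSEQ_subseq_LIMSEQ[OF quad_lim s(1)] by (simp add: comp_def u_def ric_eq_stage[OF X(1,2)])
    ultimately have "quad P v = stage P1 P2 v u'" by (rule LIMSEQ_unique[rotated])
    then show "quad (ric P1 P2) v \<le> quad P v" using ric_le_stage[OF P] by simp
  qed
qed

text \<open>Young's inequality separates the control from the free motion at the price of a factor
  \<open>1 + \<epsilon>\<close>, and positive definiteness of \<open>R\<close> charges the control
  part to the control cost. The growth of \<open>c\<close> for small \<open>\<epsilon>\<close> is
  harmless wherever the cost is annihilated.\<close>

lemma closed_loop_le:
  assumes P: "\<And>v. 0 \<le> quad P1 v" "\<And>v. 0 \<le> quad P2 v" and \<epsilon>: "\<epsilon> > 0"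
  obtains c where "c \<ge> 0" "\<And>v. quad P1 ((A + B ** L) *v v) + \<sigma>\<^sup>2 * quad P2 ((C + D ** L) *v v) \<le>
    (1 + \<epsilon>) * (quad P1 (A *v v) + \<sigma>\<^sup>2 * quad P2 (C *v v)) + c * quad R (L *v v)"
proof -
  obtain r where r: "r > 0" "\<And>v. r * (v \<bullet> v) \<le> quad R v" using pos_def_imp_lower_bound[OF R] by blast
  have young: "quad P (x + y) \<le> (1 + \<epsilon>) * quad P x + (1 + 1 / \<epsilon>) * quad P y"
    if "\<And>v. 0 \<le> quad P v" for P :: "real^'n^'n" and x y
  proof -
    have "0 \<le> quad P (\<epsilon> *\<^sub>R x - y) / \<epsilon>" using that \<epsilon> by simp
    also have "\<dots> = (1 + \<epsilon>) * quad P x + (1 + 1 / \<epsilon>) * quad P y - quad P (x + y)"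
      using \<epsilon> unfolding quad_def by (simp add: algebra_simps inner_add_left inner_add_right inner_diff_left inner_diff_right matrix_vector_mult_scaleR) (simp add: field_simps)
    finally show ?thesis by simp
  qed
  \<comment> \<open>The factor \<open>1 + 1 / \<epsilon>\<close> is Young's weight, the norms bound
    the forms of \<open>B *v u\<close> and \<open>D *v u\<close> by \<open>u \<bullet> u\<close>,
    and \<open>1 / r\<close> passes from there to \<open>quad R u\<close>.\<close>
  define c where "c = (1 + 1 / \<epsilon>) * (norm (transpose B ** P1 ** B) + \<sigma>\<^sup>2 * norm (transpose D ** P2 ** D)) / r"
  show thesis
  proof (rule that[of c])
    show "c \<ge> 0" using \<epsilon> r by (simp add: c_def)
    fix v
    define u where "u = L *v v"
    have "quad P1 (B *v u) \<le> norm (transpose B ** P1 ** B) * (u \<bullet> u)"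
      using abs_quad_le[of "transpose B ** P1 ** B" u] by simp
    moreover have "quad P2 (D *v u) \<le> norm (transpose D ** P2 ** D) * (u \<bullet> u)"
      using abs_quad_le[of "transpose D ** P2 ** D" u] by simp
    ultimately have "quad P1 (B *v u) + \<sigma>\<^sup>2 * quad P2 (D *v u) \<le> norm (transpose B ** P1 ** B) * (u \<bullet> u) + \<sigma>\<^sup>2 * (norm (transpose D ** P2 ** D) * (u \<bullet> u))"
      by (intro add_mono mult_left_mono) auto
    then have "(1 + 1 / \<epsilon>) * (quad P1 (B *v u) + \<sigma>\<^sup>2 * quad P2 (D *v u)) \<le>
        (1 + 1 / \<epsilon>) * (norm (transpose B ** P1 ** B) * (u \<bullet> u) + \<sigma>\<^sup>2 * (norm (transpose D ** P2 ** D) * (u \<bullet> u)))"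
      using \<epsilon> by (intro mult_left_mono) auto
    also have "\<dots> = c * (r * (u \<bullet> u))" using r(1) by (simp add: c_def field_simps)
    also have "\<dots> \<le> c * quad R u" using r(2) \<open>c \<ge> 0\<close> by (intro mult_left_mono) auto
    finally have 1: "(1 + 1 / \<epsilon>) * (quad P1 (B *v u) + \<sigma>\<^sup>2 * quad P2 (D *v u)) \<le> c * quad R u" .
    have "quad P1 (A *v v + B *v u) + \<sigma>\<^sup>2 * quad P2 (C *v v + D *v u) \<le>
      ((1 + \<epsilon>) * quad P1 (A *v v) + (1 + 1 / \<epsilon>) * quad P1 (B *v u)) + \<sigma>\<^sup>2 * ((1 + \<epsilon>) * quad P2 (C *v v) + (1 + 1 / \<epsilon>) * quad P2 (D *v u))"
      by (intro add_mono mult_left_mono young P) auto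
    with 1 show "quad P1 ((A + B ** L) *v v) + \<sigma>\<^sup>2 * quad P2 ((C + D ** L) *v v) \<le>
      (1 + \<epsilon>) * (quad P1 (A *v v) + \<sigma>\<^sup>2 * quad P2 (C *v v)) + c * quad R (L *v v)"
      by (simp add: u_def[symmetric] matrix_vector_mult_add_rdistrib matrix_vector_mul_assoc[symmetric] algebra_simps)
  qed
qed

end

section \<open>Fixed points of the coupled Riccati map\<close>

text \<open>\<open>N = mat 1 - G ** Q\<close> projects onto the kernel of \<open>Q\<close>. The
  complement \<open>G *v (Q *v v)\<close> is controlled by \<open>quad Q v\<close> through
  \<open>pos_semidef_quad_bound_image\<close>, and the factor 2 is the parallelogram law. One
  \<open>N\<close> serves all forms \<open>P\<close>; only \<open>c\<close> depends on
  \<open>P\<close>.\<close>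

lemma kernel_projection_bound:
  fixes Q :: "real^'n^'n"
  assumes Q: "pos_semidef Q"
  obtains N where "\<And>v. Q *v (N *v v) = 0"
    and "\<And>P. (\<And>v. 0 \<le> quad P v) \<Longrightarrow> \<exists>c\<ge>0. \<forall>v. quad P v \<le> 2 * quad P (N *v v) + c * quad Q v"
proof -
  obtain G :: "real^'n^'n" where G: "\<And>v. Q *v (G *v (Q *v v)) = Q *v v"
    using matrix_generalized_inverse[of Q] by blast
  define N where "N = mat 1 - G ** Q"
  have N: "N *v v = v - G *v (Q *v v)" for v
    by (simp add: N_def matrix_vector_mult_diff_rdistrib matrix_vector_mul_assoc)
  have "Q *v (N *v v) = 0" for v
    by (simp add: N matrix_vector_mult_diff_distrib G)
  moreover have "\<exists>c\<ge>0. \<forall>v. quad P v \<le> 2 * quad P (N *v v) + c * quad Q v"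
    if P: "\<And>v. 0 \<le> quad P v" for P
  proof (intro exI conjI allI)
    define c where "c = 2 * norm (transpose G ** P ** G) * norm Q"
    show "0 \<le> c" by (simp add: c_def)
    fix v
    define x y where "x = N *v v" and "y = G *v (Q *v v)"
    have v: "v = x + y" by (simp add: x_def y_def N)
    have "0 \<le> quad P (x - y)" by (rule P)
    also have "\<dots> = 2 * quad P x + 2 * quad P y - quad P (x + y)"
      unfolding quad_def by (simp add: algebra_simps inner_add_left inner_add_right inner_diff_left inner_diff_right)
    finally have 1: "quad P v \<le> 2 * quad P x + 2 * quad P y" by (simp add: v)
    have "quad P y \<le> norm (transpose G ** P ** G) * ((Q *v v) \<bullet> (Q *v v))"
      using abs_quad_le[of "transpose G ** P ** G" "Q *v v"] by (simp add: y_def)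
    also have "\<dots> \<le> norm (transpose G ** P ** G) * (norm Q * quad Q v)"
      by (intro mult_left_mono pos_semidef_quad_bound_image Q) simp
    finally show "quad P v \<le> 2 * quad P (N *v v) + c * quad Q v"
      using 1 by (simp add: c_def x_def)
  qed
  ultimately show thesis by (rule that)
qed

locale mean_field_lq =
  fixes \<sigma> :: real
    and A Ab C Cb Q Qb :: "real^'n^'n"
    and B Bb D Db :: "real^'m^'n"
    and R Rb :: "real^'m^'m"
  assumes R: "pos_def R" and R_hat: "pos_def (R + Rb)"
    and Q: "pos_semidef Q" and Q_hat: "pos_semidef (Q + Qb)"
begin

sublocale dev: riccati_map \<sigma> A C Q B D R
  by unfold_locales (fact R Q)+

sublocale avg: riccati_map \<sigma> "A + Ab" "C + Cb" "Q + Qb" "B + Bb" "D + Db" "R + Rb"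
  by unfold_locales (fact R_hat Q_hat)+

text \<open>\<open>Lh\<close> stands for \<open>L + Lb\<close>: the gain \<open>L\<close> acts on
  the deviation, the sum of both gains on the mean.\<close>

definition step ::
    "real^'n^'m \<Rightarrow> real^'n^'m \<Rightarrow> (real^'n^'n) \<times> (real^'n^'n) \<Rightarrow> (real^'n^'n) \<times> (real^'n^'n)" where
  "step L Lh = lyap \<sigma> (A + B ** L) (C + D ** L) (A + Ab + (B + Bb) ** Lh) (C + Cb + (D + Db) ** Lh)"

definition free :: "(real^'n^'n) \<times> (real^'n^'n) \<Rightarrow> (real^'n^'n) \<times> (real^'n^'n)" where
  "free = lyap \<sigma> A C (A + Ab) (C + Cb)"

definition cost :: "real^'n^'m \<Rightarrow> real^'n^'m \<Rightarrow> (real^'n^'n) \<times> (real^'n^'n)" where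
  "cost L Lh = (Q + transpose L ** R ** L, Q + Qb + transpose Lh ** (R + Rb) ** Lh)"

definition Ric :: "(real^'n^'n) \<times> (real^'n^'n) \<Rightarrow> (real^'n^'n) \<times> (real^'n^'n)" where
  "Ric p = (dev.ric (fst p) (fst p), avg.ric (snd p) (fst p))"

abbreviation K_dev :: "(real^'n^'n) \<times> (real^'n^'n) \<Rightarrow> real^'n^'m" where
  "K_dev p \<equiv> dev.gain (fst p) (fst p)"

abbreviation K_avg :: "(real^'n^'n) \<times> (real^'n^'n) \<Rightarrow> real^'n^'m" where
  "K_avg p \<equiv> avg.gain (snd p) (fst p)"

lemma linear_step: "linear (step L Lh)" and step_nonneg: "p \<in> nonneg_forms \<Longrightarrow> step L Lh p \<in> nonneg_forms"
  and step_funpow_nonneg: "p \<in> nonneg_forms \<Longrightarrow> (step L Lh ^^ k) p \<in> nonneg_forms"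
  by (simp_all add: step_def linear_lyap lyap_nonneg lyap_funpow_nonneg)

lemma cost_nonneg: "cost L Lh \<in> nonneg_forms"
  by (simp add: nonneg_forms_def cost_def dev.Q_nonneg dev.R_nonneg avg.Q_nonneg[simplified] avg.R_nonneg[simplified])

lemma quad_cost_step:
  "quad (fst (cost L Lh + step L Lh p)) v = dev.stage (fst p) (fst p) v (L *v v)"
  "quad (snd (cost L Lh + step L Lh p)) v = avg.stage (snd p) (fst p) v (Lh *v v)"
  by (simp_all add: cost_def step_def quad_lyap dev.stage_def avg.stage_def matrix_vector_mult_add_rdistrib
      matrix_vector_mul_assoc[symmetric] add.assoc)

lemma Ric_le_step: "psd_pair p \<Longrightarrow> cost L Lh + step L Lh p - Ric p \<in> nonneg_forms"
  unfolding nonneg_forms_def mem_Collect_eq fst_diff snd_diff quad_diff quad_cost_step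
  by (simp add: psd_pair_iff Ric_def dev.ric_le_stage avg.ric_le_stage)

lemma psd_pair_Ric: "psd_pair p \<Longrightarrow> psd_pair (Ric p)"
  by (simp add: psd_pair_iff Ric_def dev.ric_pos_semidef avg.ric_pos_semidef)

lemma symmetric_cost: "symmetric_pair (cost L Lh)"
  using dev.R_sym dev.Q_sym avg.R_sym avg.Q_sym
  by (simp add: symmetric_pair_def cost_def transpose_add[symmetric] transpose_congr)
    (simp add: transpose_add transpose_congr)

lemma Ric_eq_step:
  assumes p: "psd_pair p"
  shows "Ric p = cost (K_dev p) (K_avg p) + step (K_dev p) (K_avg p) p"
proof -
  have s1: "symmetric_pair (Ric p)" using psd_pair_Ric[OF p] by (simp add: psd_pair_def)
  have s2: "symmetric_pair (cost (K_dev p) (K_avg p) + step (K_dev p) (K_avg p) p)"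
    using p symmetric_cost[of "K_dev p" "K_avg p"] symmetric_lyap[of p]
    unfolding psd_pair_def step_def by (simp add: symmetric_pair_def transpose_add)
  show ?thesis
  proof (rule prod_eqI; rule symmetric_quad_eqI)
    fix v
    show "quad (fst (Ric p)) v = quad (fst (cost (K_dev p) (K_avg p) + step (K_dev p) (K_avg p) p)) v"
      unfolding quad_cost_step using p by (simp add: Ric_def dev.ric_eq_stage psd_pair_iff)
    show "quad (snd (Ric p)) v = quad (snd (cost (K_dev p) (K_avg p) + step (K_dev p) (K_avg p) p)) v"
      unfolding quad_cost_step using p by (simp add: Ric_def avg.ric_eq_stage psd_pair_iff)
  qed (use s1 s2 in \<open>auto simp: symmetric_pair_def\<close>)
qed

lemma Ric_mono:
  assumes "psd_pair p" "psd_pair q" "q - p \<in> nonneg_forms"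
  shows "Ric q - Ric p \<in> nonneg_forms"
  using assms
  by (auto simp: nonneg_forms_def psd_pair_iff Ric_def intro!: dev.ric_mono avg.ric_mono)

theorem Ric_fixpoint_exists:
  assumes stable: "\<And>z. z \<in> forms.dual_cone \<Longrightarrow> summable (\<lambda>k. z \<bullet> (step L Lh ^^ k) unit_forms)"
  obtains p where "psd_pair p" "Ric p = p"
proof -
  define X where "X k = (Ric ^^ k) 0" for k
  have X_Suc: "X (Suc k) = Ric (X k)" for k by (simp add: X_def)
  have psd: "psd_pair (X k)" for k
    by (induction k) (simp_all add: X_def psd_pair_Ric, simp add: psd_pair_iff pos_semidef_quad transpose_def vec_eq_iff)
  have mono: "X (Suc k) - X k \<in> nonneg_forms" for k
  proof (induction k)
    case 0
    show ?case using psd[of 1] by (simp add: psd_pair_def X_def)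
  next
    case (Suc k)
    show ?case unfolding X_Suc[of "Suc k"] X_Suc[of k] by (rule Ric_mono) (use Suc psd[of k] psd[of "Suc k"] in \<open>simp_all add: X_Suc\<close>)
  qed
  \<comment> \<open>The cost of the fixed feedback over \<open>k\<close> stages, as a pair of forms;
    its recursion is value iteration without the minimisation.\<close>
  define S where "S k = (\<Sum>j<k. (step L Lh ^^ j) (cost L Lh))" for k
  have S_Suc: "S (Suc k) = cost L Lh + step L Lh (S k)" for k
    unfolding S_def by (subst sum.lessThan_Suc_shift) (simp add: linear_sum[OF linear_step])
  have upper: "S k - X k \<in> nonneg_forms" for k
  proof (induction k)
    case 0
    show ?case by (simp add: S_def X_def nonneg_forms_def)
  next
    case (Suc k)
    \<comment> \<open>The old gap is carried on by a positive map, and the bracket is the loss from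
      using \<open>L\<close>, \<open>Lh\<close> in place of the minimiser.\<close>
    have "S (Suc k) - X (Suc k) = step L Lh (S k - X k) + (cost L Lh + step L Lh (X k) - Ric (X k))"
      by (simp add: S_Suc X_Suc linear_diff[OF linear_step])
    then show ?case using step_nonneg[OF Suc, of L Lh] Ric_le_step[OF psd[of k], of L Lh]
      by (simp add: nonneg_forms_def)
  qed
  \<comment> \<open>Dual functionals turn the order bounds into bounded increasing real sequences;
    rank-one functionals and polarisation then give convergence of the matrices.\<close>
  have conv: "convergent (\<lambda>k. z \<bullet> X k)" if z: "z \<in> forms.dual_cone" for z
  proof -
    have inc: "incseq (\<lambda>k. z \<bullet> X k)"
      using forms.dual_coneD[OF z mono] by (intro incseq_SucI) (simp add: inner_diff_right)
    have "z \<bullet> X k \<le> norm (cost L Lh) * (\<Sum>k. z \<bullet> (step L Lh ^^ k) unit_forms)" for k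
    proof -
      have "z \<bullet> X k \<le> z \<bullet> S k"
        using forms.dual_coneD[OF z upper[of k]] by (simp add: inner_diff_right)
      also have "\<dots> \<le> norm (cost L Lh) * (\<Sum>k. z \<bullet> (step L Lh ^^ k) unit_forms)"
        unfolding S_def inner_sum_right
        by (rule forms.orbit_sum_bounded[OF step_nonneg linear_step z stable[OF z]])
      finally show ?thesis .
    qed
    then have "\<forall>k. z \<bullet> X k \<le> norm (cost L Lh) * (\<Sum>k. z \<bullet> (step L Lh ^^ k) unit_forms)" ..
    from incseq_convergent[OF inc this] show ?thesis
      by (auto simp: convergent_def)
  qed
  have sym: "transpose (fst (X k)) = fst (X k)" "transpose (snd (X k)) = snd (X k)" for k
    using psd[of k] by (simp_all add: psd_pair_def symmetric_pair_def)
  obtain P1 where P1: "(\<lambda>k. fst (X k)) \<longlonglongrightarrow> P1" "transpose P1 = P1"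
    by (rule symmetric_convergent[of "\<lambda>k. fst (X k)"]) (use conv[OF outer_dual(1)] sym in \<open>simp_all add: inner_outer_fst\<close>)
  obtain P2 where P2: "(\<lambda>k. snd (X k)) \<longlonglongrightarrow> P2" "transpose P2 = P2"
    by (rule symmetric_convergent[of "\<lambda>k. snd (X k)"]) (use conv[OF outer_dual(2)] sym in \<open>simp_all add: inner_outer_snd\<close>)
  have psdX: "pos_semidef (fst (X k))" "pos_semidef (snd (X k))" for k
    using psd[of k] by (simp_all add: psd_pair_iff)
  have psd1: "pos_semidef P1"
    using LIMSEQ_le_const[OF tendsto_quad[OF P1(1) tendsto_const]] psdX(1) P1(2)
    unfolding pos_semidef_quad by blast
  have psd2: "pos_semidef P2"
    using LIMSEQ_le_const[OF tendsto_quad[OF P2(1) tendsto_const]] psdX(2) P2(2)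
    unfolding pos_semidef_quad by blast
  have "P1 = dev.ric P1 P1"
    by (rule dev.ric_limit[OF psdX(1) psdX(1) P1(1) P1(1) psd1 psd1])
      (use LIMSEQ_Suc[OF P1(1)] in \<open>simp add: X_Suc Ric_def\<close>)
  moreover have "P2 = avg.ric P2 P1"
    by (rule avg.ric_limit[OF psdX(2) psdX(1) P2(1) P1(1) psd2 psd1])
      (use LIMSEQ_Suc[OF P2(1)] in \<open>simp add: X_Suc Ric_def\<close>)
  ultimately show thesis
    using psd1 psd2 by (intro that[of "(P1, P2)"]) (simp_all add: psd_pair_iff Ric_def)
qed

text \<open>Exact detectability at horizon 0, stripped of random vectors. The \<open>fst\<close>
  part describes initial deviations along \<open>a\<close>, the \<open>snd\<close> part the
  deterministic initial state \<open>a\<close>; the forms evaluate the second moment at time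
  \<open>j\<close>, in the first case up to a positive factor.\<close>

definition detectable_forms :: bool where
  "detectable_forms \<longleftrightarrow>
     (\<forall>a. Q *v a = 0 \<longrightarrow> (\<lambda>j. quad (fst ((free ^^ j) unit_forms)) a) \<longlonglongrightarrow> 0) \<and>
     (\<forall>a. (Q + Qb) *v a = 0 \<longrightarrow> (\<lambda>j. quad (snd ((free ^^ j) unit_forms)) a) \<longlonglongrightarrow> 0)"

lemma free_orbit_nonneg: "(free ^^ j) unit_forms \<in> nonneg_forms"
  unfolding free_def by (rule lyap_funpow_nonneg[OF forms.unit_in_cone])

text \<open>\<open>Z\<close> need not come from a vector in the kernel. The kernel projections bound
  each form of the orbit by a part that decays by detectability and a multiple of
  \<open>(Q, Q + Qb)\<close>. \<open>Z\<close> annihilates the latter, so \<open>c1\<close> and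
  \<open>c2\<close> may depend on \<open>j\<close> without any bound.\<close>

lemma free_orbit_decay:
  assumes det: "detectable_forms" and Z: "Z \<in> forms.dual_cone" and Z0: "Z \<bullet> (Q, Q + Qb) = 0"
  shows "(\<lambda>j. Z \<bullet> (free ^^ j) unit_forms) \<longlonglongrightarrow> 0"
proof -
  define p where "p j = (free ^^ j) unit_forms" for j
  have p: "p j \<in> nonneg_forms" for j unfolding p_def by (rule free_orbit_nonneg)
  have psym: "transpose (fst (p j)) = fst (p j)" "transpose (snd (p j)) = snd (p j)" for j
    using symmetric_lyap_funpow[OF symmetric_unit] unfolding p_def free_def symmetric_pair_def by blast+
  obtain N1 where N1: "\<And>v. Q *v (N1 *v v) = 0"
    "\<And>P. (\<And>v. 0 \<le> quad P v) \<Longrightarrow> \<exists>c\<ge>0. \<forall>v. quad P v \<le> 2 * quad P (N1 *v v) + c * quad Q v"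
    using kernel_projection_bound[OF Q] by blast
  obtain N2 where N2: "\<And>v. (Q + Qb) *v (N2 *v v) = 0"
    "\<And>P. (\<And>v. 0 \<le> quad P v) \<Longrightarrow> \<exists>c\<ge>0. \<forall>v. quad P v \<le> 2 * quad P (N2 *v v) + c * quad (Q + Qb) v"
    using kernel_projection_bound[OF Q_hat] by blast
  define q where "q j = (transpose N1 ** fst (p j) ** N1, transpose N2 ** snd (p j) ** N2)" for j
  have "q \<longlonglongrightarrow> (0, 0)"
    unfolding q_def
    by (intro tendsto_Pair symmetric_tendsto_0 transpose_congr psym; unfold quad_congr)
      (use det N1(1) N2(1) in \<open>simp_all add: detectable_forms_def p_def\<close>)
  then have lim: "(\<lambda>j. 2 * (Z \<bullet> q j)) \<longlonglongrightarrow> 2 * (Z \<bullet> (0, 0))"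
    by (intro tendsto_intros)
  have le: "Z \<bullet> p j \<le> 2 * (Z \<bullet> q j)" for j
  proof -
    obtain c1 where c1: "c1 \<ge> 0" "\<And>v. quad (fst (p j)) v \<le> 2 * quad (fst (p j)) (N1 *v v) + c1 * quad Q v"
      using N1(2)[of "fst (p j)"] p[of j] by (auto simp: nonneg_forms_def)
    obtain c2 where c2: "c2 \<ge> 0" "\<And>v. quad (snd (p j)) v \<le> 2 * quad (snd (p j)) (N2 *v v) + c2 * quad (Q + Qb) v"
      using N2(2)[of "snd (p j)"] p[of j] by (auto simp: nonneg_forms_def)
    \<comment> \<open>One coefficient \<open>c1 + c2\<close> serves both components, since
      \<open>Z\<close> is given to vanish on the pair \<open>(Q, Q + Qb)\<close> as a whole.\<close>
    have "2 *\<^sub>R q j + (c1 + c2) *\<^sub>R (Q, Q + Qb) - p j \<in> nonneg_forms"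
      unfolding nonneg_forms_def mem_Collect_eq
    proof (intro allI conjI)
      fix v
      have "0 \<le> c2 * quad Q v" "0 \<le> c1 * quad (Q + Qb) v"
        using c1(1) c2(1) dev.Q_nonneg avg.Q_nonneg by simp_all
      with c1(2)[of v] c2(2)[of v]
      show "0 \<le> quad (fst (2 *\<^sub>R q j + (c1 + c2) *\<^sub>R (Q, Q + Qb) - p j)) v"
        and "0 \<le> quad (snd (2 *\<^sub>R q j + (c1 + c2) *\<^sub>R (Q, Q + Qb) - p j)) v"
        by (simp_all add: q_def algebra_simps)
    qed
    from forms.dual_coneD[OF Z this] show ?thesis
      unfolding inner_add_right inner_diff_right inner_scaleR_right Z0 by simp
  qed
  have "(\<lambda>j. Z \<bullet> p j) \<longlonglongrightarrow> 0"
  proof (rule tendsto_sandwich)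
    show "\<forall>\<^sub>F j in sequentially. 0 \<le> Z \<bullet> p j" by (simp add: forms.dual_coneD[OF Z p])
    show "\<forall>\<^sub>F j in sequentially. Z \<bullet> p j \<le> 2 * (Z \<bullet> q j)" by (simp add: le)
    show "(\<lambda>j. 2 * (Z \<bullet> q j)) \<longlonglongrightarrow> 0" using lim by (simp add: zero_prod_def[symmetric])
  qed simp
  then show ?thesis by (simp add: p_def)
qed

text \<open>A functional that vanishes on the cost sees no control action, up to an arbitrarily small
  factor by Young's inequality.\<close>

lemma step_le_free:
  assumes Z: "Z \<in> forms.dual_cone" and Z0: "Z \<bullet> (step L Lh ^^ i) (cost L Lh) = 0" and p: "p \<in> nonneg_forms"
  shows "Z \<bullet> (step L Lh ^^ i) (step L Lh p) \<le> Z \<bullet> (step L Lh ^^ i) (free p)"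
proof (rule LIMSEQ_le_const)
  show "(\<lambda>n. (1 + inverse (real (Suc n))) * (Z \<bullet> (step L Lh ^^ i) (free p))) \<longlonglongrightarrow> Z \<bullet> (step L Lh ^^ i) (free p)"
    using tendsto_mult[OF LIMSEQ_inverse_real_of_nat_add[of 1] tendsto_const] by simp
  have "Z \<bullet> (step L Lh ^^ i) (step L Lh p) \<le> (1 + \<epsilon>) * (Z \<bullet> (step L Lh ^^ i) (free p))" if \<epsilon>: "\<epsilon> > 0" for \<epsilon>
  proof -
    have pf: "0 \<le> quad (fst p) v" "0 \<le> quad (snd p) v" for v using p by (simp_all add: nonneg_forms_def)
    obtain c1 where c1: "c1 \<ge> 0" "\<And>v. quad (fst p) ((A + B ** L) *v v) + \<sigma>\<^sup>2 * quad (fst p) ((C + D ** L) *v v) \<le>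
        (1 + \<epsilon>) * (quad (fst p) (A *v v) + \<sigma>\<^sup>2 * quad (fst p) (C *v v)) + c1 * quad R (L *v v)"
      using dev.closed_loop_le[of "fst p" "fst p" \<epsilon> L, OF pf(1) pf(1) \<epsilon>] by blast
    obtain c2 where c2: "c2 \<ge> 0" "\<And>v. quad (snd p) ((A + Ab + (B + Bb) ** Lh) *v v) + \<sigma>\<^sup>2 * quad (fst p) ((C + Cb + (D + Db) ** Lh) *v v) \<le>
        (1 + \<epsilon>) * (quad (snd p) ((A + Ab) *v v) + \<sigma>\<^sup>2 * quad (fst p) ((C + Cb) *v v)) + c2 * quad (R + Rb) (Lh *v v)"
      using avg.closed_loop_le[of "snd p" "fst p" \<epsilon> Lh, OF pf(2) pf(1) \<epsilon>] by blast
    have "(1 + \<epsilon>) *\<^sub>R free p + (c1 + c2) *\<^sub>R cost L Lh - step L Lh p \<in> nonneg_forms"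
      unfolding nonneg_forms_def mem_Collect_eq
    proof (intro allI conjI)
      fix v
      have "0 \<le> c1 * quad Q v" "0 \<le> c2 * quad Q v" "0 \<le> c2 * quad R (L *v v)"
        "0 \<le> c1 * quad (Q + Qb) v" "0 \<le> c2 * quad (Q + Qb) v" "0 \<le> c1 * quad (R + Rb) (Lh *v v)"
        using c1(1) c2(1) dev.Q_nonneg avg.Q_nonneg dev.R_nonneg avg.R_nonneg by simp_all
      with c1(2)[of v] c2(2)[of v]
      show "0 \<le> quad (fst ((1 + \<epsilon>) *\<^sub>R free p + (c1 + c2) *\<^sub>R cost L Lh - step L Lh p)) v"
        and "0 \<le> quad (snd ((1 + \<epsilon>) *\<^sub>R free p + (c1 + c2) *\<^sub>R cost L Lh - step L Lh p)) v"
        by (simp_all add: free_def step_def cost_def quad_lyap algebra_simps)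
    qed
    from forms.dual_coneD[OF Z step_funpow_nonneg[OF this, where L = L and Lh = Lh and k = i]]
    show ?thesis
      unfolding linear_diff[OF linear_funpow[OF linear_step]] linear_add[OF linear_funpow[OF linear_step]]
        linear_scale[OF linear_funpow[OF linear_step]] inner_diff_right inner_add_right inner_scaleR_right Z0
      by simp
  qed
  then show "\<exists>N. \<forall>n\<ge>N. Z \<bullet> (step L Lh ^^ i) (step L Lh p) \<le> (1 + inverse (real (Suc n))) * (Z \<bullet> (step L Lh ^^ i) (free p))"
    by simp
qed

text \<open>Factors are exchanged one by one, the innermost first. The exchange under
  \<open>step L Lh ^^ i\<close> uses zero cost at time \<open>i\<close>, so the induction keeps
  \<open>i\<close> arbitrary.\<close>

lemma step_orbit_le_free:
  assumes Z: "Z \<in> forms.dual_cone" and Z0: "\<And>j. Z \<bullet> (step L Lh ^^ j) (cost L Lh) = 0"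
  shows "p \<in> nonneg_forms \<Longrightarrow> Z \<bullet> (step L Lh ^^ j) p \<le> Z \<bullet> (free ^^ j) p"
proof -
  have "Z \<bullet> (step L Lh ^^ (i + j)) p \<le> Z \<bullet> (step L Lh ^^ i) ((free ^^ j) p)" if "p \<in> nonneg_forms" for i
  proof (induction j arbitrary: i)
    case (Suc j)
    have "Z \<bullet> (step L Lh ^^ (i + Suc j)) p \<le> Z \<bullet> (step L Lh ^^ (Suc i)) ((free ^^ j) p)"
      using Suc[of "Suc i"] by simp
    also have "\<dots> = Z \<bullet> (step L Lh ^^ i) (step L Lh ((free ^^ j) p))"
      by (simp add: funpow_swap1)
    also have "\<dots> \<le> Z \<bullet> (step L Lh ^^ i) (free ((free ^^ j) p))"
      using that by (intro step_le_free Z Z0) (simp add: free_def lyap_funpow_nonneg)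
    finally show ?case by simp
  qed simp
  from this[of 0] show "p \<in> nonneg_forms \<Longrightarrow> Z \<bullet> (step L Lh ^^ j) p \<le> Z \<bullet> (free ^^ j) p" by simp
qed

theorem fixpoint_gain_stable:
  assumes det: "detectable_forms" and p: "psd_pair p" "Ric p = p" and z: "z \<in> forms.dual_cone"
  shows "summable (\<lambda>k. z \<bullet> (step (K_dev p) (K_avg p) ^^ k) unit_forms)"
proof (rule forms.summable_orbit[OF linear_step step_nonneg cost_nonneg _ _ _ z])
  show "p \<in> nonneg_forms" using p by (simp add: psd_pair_def)
  show "p = cost (K_dev p) (K_avg p) + step (K_dev p) (K_avg p) p" using Ric_eq_step[OF p(1)] p(2) by simp
  fix Z :: "(real^'n^'n) \<times> (real^'n^'n)"
  assume Z: "Z \<in> forms.dual_cone" and Z0: "\<And>j. Z \<bullet> (step (K_dev p) (K_avg p) ^^ j) (cost (K_dev p) (K_avg p)) = 0"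
  have "(Q, Q + Qb) \<in> nonneg_forms" "cost (K_dev p) (K_avg p) - (Q, Q + Qb) \<in> nonneg_forms"
    using dev.Q_nonneg dev.R_nonneg avg.Q_nonneg avg.R_nonneg by (simp_all add: nonneg_forms_def cost_def)
  \<comment> \<open>The running cost at \<open>j = 0\<close> dominates the state cost, so a positive
    functional that annihilates the former annihilates the latter.\<close>
  from this[THEN forms.dual_coneD[OF Z]] have "Z \<bullet> (Q, Q + Qb) = 0"
    using Z0[of 0] unfolding inner_diff_right by simp
  note decay = free_orbit_decay[OF det Z this]
  show "(\<lambda>j. Z \<bullet> (step (K_dev p) (K_avg p) ^^ j) unit_forms) \<longlonglongrightarrow> 0"
    by (rule tendsto_sandwich[OF _ _ tendsto_const decay])
      (simp_all add: step_orbit_le_free[OF Z Z0] forms.unit_in_cone forms.dual_coneD[OF Z] step_funpow_nonneg)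
qed

end

section \<open>Translation of the coupled equation into fixed-point form\<close>

lemma transpose_add_congr:
  "transpose (X + Y) ** Z ** (X + Y) =
     transpose X ** Z ** X + transpose X ** Z ** Y + transpose Y ** Z ** X + transpose Y ** Z ** Y"
  for X Y :: "real^'n^'n"
  by (simp add: transpose_add matrix_add_ldistrib matrix_add_rdistrib add_ac)

context mean_field_lq
begin

lemma riccati_matrices:
  "Upsilon1 \<sigma> B D R P = dev.U P P" "M1 \<sigma> A B C D P = dev.N P P"
  "Upsilon2 \<sigma> B Bb D Db R Rb P Pb = avg.U (P + Pb) P"
  "M2 \<sigma> A Ab B Bb C Cb D Db P Pb = avg.N (P + Pb) P"
  by (simp_all add: Upsilon1_def dev.U_def M1_def dev.N_def Upsilon2_def avg.U_def M2_def avg.N_def)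

text \<open>In \<open>K + Kb\<close> the contributions of the first equation cancel, leaving the
  gain that acts on the mean.\<close>

lemma riccati_gains:
  "gain_K \<sigma> A B C D R P = K_dev (P, P + Pb)"
  "gain_K \<sigma> A B C D R P + gain_Kb \<sigma> A Ab B Bb C Cb D Db R Rb P Pb = K_avg (P, P + Pb)"
  by (simp_all add: gain_K_def gain_Kb_def riccati_matrices dev.gain_def avg.gain_def)

text \<open>Adding the two equations cancels the \<open>M1\<close> terms and merges the products of
  \<open>A\<close>, \<open>Ab\<close> and of \<open>C\<close>, \<open>Cb\<close> into those of the
  sums: the second equation becomes a Riccati equation for \<open>P + Pb\<close>.\<close>

lemma coupled_riccati_iff:
  "coupled_riccati \<sigma> A Ab B Bb C Cb D Db Q Qb R Rb P Pb \<longleftrightarrow> Ric (P, P + Pb) = (P, P + Pb)"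
proof -
  have A_hat: "transpose (A + Ab) ** (P + Pb) ** (A + Ab) =
      transpose A ** P ** A + transpose A ** P ** Ab + transpose Ab ** P ** A + transpose Ab ** P ** Ab
      + transpose (A + Ab) ** Pb ** (A + Ab)"
    by (simp only: transpose_add matrix_add_ldistrib matrix_add_rdistrib add_ac)
  have "coupled_riccati \<sigma> A Ab B Bb C Cb D Db Q Qb R Rb P Pb \<longleftrightarrow>
      P = dev.ric P P \<and> Pb = avg.ric (P + Pb) P - dev.ric P P"
    unfolding coupled_riccati_def riccati_matrices Let_def dev.ric_def avg.ric_def A_hat transpose_add_congr[of C]
    by (simp add: scaleR_add_right algebra_simps)
  then show ?thesis by (auto simp: Ric_def algebra_simps)
qed

lemma riccati_solution_iff:
  "riccati_solution \<sigma> A Ab B Bb C Cb D Db Q Qb R Rb P Pb \<longleftrightarrow>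
     psd_pair (P, P + Pb) \<and> Ric (P, P + Pb) = (P, P + Pb)"
  by (auto simp: riccati_solution_def coupled_riccati_iff psd_pair_iff pos_semidef_def transpose_add)

end

section \<open>Moments under white noise\<close>

lemma borel_measurable_matrix_vector_mult [measurable]:
  "(\<lambda>v. P *v v) \<in> borel_measurable borel" for P :: "real^'n^'m"
  by (intro borel_measurable_continuous_onI linear_continuous_on) simp

lemma measurable_sets_mono:
  "h \<in> measurable N L \<Longrightarrow> sets N \<subseteq> sets N' \<Longrightarrow> space N = space N' \<Longrightarrow> h \<in> measurable N' L"
  by (auto simp: measurable_def)

locale white_noise_space = prob_space M for M :: "'w measure" +
  fixes w :: "nat \<Rightarrow> 'w \<Rightarrow> real" and \<sigma> :: real
  assumes white: "white_noise M w \<sigma>"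
begin

text \<open>The information without null sets. Independence from the next noise is derived from its
  generators, and measurability carries over to \<open>past_info\<close>, which has more
  sets.\<close>

definition history :: "('w \<Rightarrow> real^'n) \<Rightarrow> nat \<Rightarrow> 'w measure" where
  "history x0 k = sigma (space M)
     ({x0 -` S \<inter> space M | S. S \<in> sets borel} \<union> {w i -` S \<inter> space M | i S. i < k \<and> S \<in> sets borel})"

lemma w_measurable [measurable]: "w k \<in> borel_measurable M"
  using white unfolding white_noise_def indep_vars_def by simp

lemma w_square_integrable: "integrable M (\<lambda>\<omega>. (w k \<omega>)\<^sup>2)"
  and w_integrable: "integrable M (w k)"
  and w_mean: "(\<integral>\<omega>. w k \<omega> \<partial>M) = 0"
  and w_second_moment: "(\<integral>\<omega>. (w k \<omega>)\<^sup>2 \<partial>M) = \<sigma>\<^sup>2"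
proof -
  show *: "integrable M (\<lambda>\<omega>. (w k \<omega>)\<^sup>2)" "(\<integral>\<omega>. w k \<omega> \<partial>M) = 0"
    using white by (auto simp: white_noise_def)
  have "expectation (\<lambda>\<omega>. (w k \<omega> - expectation (w k))\<^sup>2) = \<sigma>\<^sup>2"
    using white unfolding white_noise_def by blast
  then show "(\<integral>\<omega>. (w k \<omega>)\<^sup>2 \<partial>M) = \<sigma>\<^sup>2" using *(2) by simp
  show "integrable M (w k)" by (rule square_integrable_imp_integrable[OF w_measurable *(1)])
qed

lemma space_history [simp]: "space (history x0 k) = space M"
  by (simp add: history_def space_measure_of_conv)

lemma sets_history:
  "sets (history x0 k) = sigma_sets (space M)
     ({x0 -` S \<inter> space M | S. S \<in> sets borel} \<union> {w i -` S \<inter> space M | i S. i < k \<and> S \<in> sets borel})"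
  unfolding history_def by (rule sets_measure_of) auto

lemma initial_measurable_history: "x0 \<in> borel_measurable (history x0 k)"
  by (rule measurableI) (auto simp: sets_history intro!: sigma_sets.Basic)

lemma noise_measurable_history: "i < k \<Longrightarrow> w i \<in> borel_measurable (history x0 k)"
  by (rule measurableI) (auto simp: sets_history intro!: sigma_sets.Basic)

lemma history_mono: "k \<le> l \<Longrightarrow> sets (history x0 k) \<subseteq> sets (history x0 l)"
  unfolding sets_history by (intro sigma_sets_mono' Un_mono order_refl) (blast intro: less_le_trans)

lemma measurable_history_mono:
  "h \<in> borel_measurable (history x0 k) \<Longrightarrow> k \<le> l \<Longrightarrow> h \<in> borel_measurable (history x0 l)"
  by (erule measurable_sets_mono[OF _ history_mono]) simp_all

lemma measurable_history_past_info:
  assumes "h \<in> borel_measurable (history x0 k)"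
  shows "h \<in> borel_measurable (past_info M x0 w k)"
proof (rule measurable_sets_mono[OF assms])
  have "sets (past_info M x0 w k) = sigma_sets (space M)
     ({x0 -` S \<inter> space M | S. S \<in> sets borel} \<union> {w i -` S \<inter> space M | i S. i < k \<and> S \<in> sets borel} \<union> null_sets M)"
    unfolding past_info_def by (rule sets_measure_of) (auto dest: sets.sets_into_space)
  then show "sets (history x0 k) \<subseteq> sets (past_info M x0 w k)"
    unfolding sets_history by (simp add: sigma_sets_mono')
  show "space (history x0 k) = space (past_info M x0 w k)"
    by (simp add: past_info_def space_measure_of_conv)
qed

lemma initial_measurable: "initial_state M w x0 \<Longrightarrow> x0 \<in> borel_measurable M"
  by (simp add: initial_state_def square_integrable_def)

text \<open>Index 0 holds the events of the initial state and \<open>Suc i\<close> those of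
  \<open>w i\<close>; families of events, unlike families of variables, allow different codomains. A
  finite intersection factors first between initial state and noise, then within the noise.\<close>

lemma indep_sources:
  assumes x0: "initial_state M w x0"
  shows "indep_sets (case_nat {x0 -` S \<inter> space M | S. S \<in> sets borel}
    (\<lambda>i. {w i -` S \<inter> space M | S. S \<in> sets borel})) UNIV" (is "indep_sets ?F UNIV")
proof (rule indep_setsI)
  have x0m [measurable]: "x0 \<in> borel_measurable M" by (rule initial_measurable[OF x0])
  show "?F i \<subseteq> events" for i
    by (cases i) (auto intro!: measurable_sets[OF x0m] measurable_sets[OF w_measurable])
  fix A J
  assume J: "J \<noteq> {}" "finite J" and A: "\<forall>j\<in>J. A j \<in> ?F j"
  define J' where "J' = Suc -` J"
  have J': "finite J'" unfolding J'_def using J(2) by (rule finite_vimageI) simp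
  define V where "V = vimage_algebra (space M) (\<lambda>\<omega> k. w k \<omega>) (Pi\<^sub>M UNIV (\<lambda>_. borel :: real measure))"
  have wV: "w i \<in> measurable V borel" for i
  proof -
    have "(\<lambda>\<omega> k. w k \<omega>) \<in> measurable V (Pi\<^sub>M UNIV (\<lambda>_. borel))"
      unfolding V_def by (rule measurable_vimage_algebra1) (simp add: space_PiM)
    from measurable_compose[OF this measurable_component_singleton[of i UNIV]] show ?thesis by simp
  qed
  have A': "A (Suc i) \<in> {w i -` S \<inter> space M | S. S \<in> sets borel}" if "i \<in> J'" for i
    using A that by (auto simp: J'_def)
  have noise: "prob (\<Inter>i\<in>J'. A (Suc i)) = (\<Prod>i\<in>J'. prob (A (Suc i)))" if "J' \<noteq> {}"
  proof (rule indep_setsD)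
    show "indep_sets (\<lambda>i. {w i -` S \<inter> space M | S. S \<in> sets borel}) UNIV"
      using white unfolding white_noise_def indep_vars_def2 by auto
  qed (use that J' A' in auto)
  have JJ: "J - {0} = Suc ` J'"
    unfolding J'_def image_vimage_eq by (auto simp: image_iff gr0_conv_Suc)
  show "prob (\<Inter>j\<in>J. A j) = (\<Prod>j\<in>J. prob (A j))"
  proof (cases "0 \<in> J")
    case False
    then have "J = Suc ` J'" using JJ by auto
    then show ?thesis using noise J(1) by (simp add: prod.reindex)
  next
    case True
    show ?thesis
    proof (cases "J' = {}")
      case True
      then have "J = {0}" using JJ \<open>0 \<in> J\<close> by auto
      then show ?thesis by simp
    next
      case False
      have J_eq: "J = insert 0 (Suc ` J')" using JJ \<open>0 \<in> J\<close> by auto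
      \<comment> \<open>A finite intersection of noise events belongs to the sigma-algebra of the
        whole sequence, and that is the one assumed independent of \<open>x0\<close>.\<close>
      have "(\<Inter>i\<in>J'. A (Suc i)) \<in> sets V"
      proof (rule sets.finite_INT[OF J' False])
        fix i assume "i \<in> J'"
        then obtain S where "A (Suc i) = w i -` S \<inter> space M" "S \<in> sets borel" using A' by blast
        then show "A (Suc i) \<in> sets V" using measurable_sets[OF wV[of i], of S] by (simp add: V_def)
      qed
      moreover have "A 0 \<in> sets (vimage_algebra (space M) x0 borel)"
        using A \<open>0 \<in> J\<close> by (auto simp: sets_vimage_algebra intro!: sigma_sets.Basic)
      ultimately have "prob (A 0 \<inter> (\<Inter>i\<in>J'. A (Suc i))) = prob (A 0) * prob (\<Inter>i\<in>J'. A (Suc i))"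
        using x0 unfolding initial_state_def V_def by (intro indep_setD) auto
      then show ?thesis using noise[OF False] J'
        by (simp add: J_eq prod.reindex)
    qed
  qed
qed

lemma indep_history_noise:
  assumes x0: "initial_state M w x0" and h: "h \<in> borel_measurable (history x0 k)"
  shows "indep_var borel h borel (w k)"
proof -
  define F where "F = case_nat {x0 -` S \<inter> space M | S. S \<in> sets borel} (\<lambda>i. {w i -` S \<inter> space M | S. S \<in> sets (borel :: real measure)})"
  \<comment> \<open>Because index 0 is the initial state, \<open>{..k}\<close> covers
    \<open>x0\<close> and the noise before time \<open>k\<close>, while \<open>Suc k\<close> is
    \<open>w k\<close>.\<close>
  define I where "I = case_bool {..k} {Suc k}"
  have "indep_sets (\<lambda>b. sigma_sets (space M) (\<Union>i\<in>I b. F i)) UNIV"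
  proof (rule indep_sets_collect_sigma)
    show "indep_sets F (\<Union>j\<in>UNIV. I j)"
      unfolding F_def by (rule indep_sets_mono_index[OF _ indep_sources[OF x0]]) simp
    show "disjoint_family_on I UNIV"
      by (auto simp: disjoint_family_on_def I_def split: bool.splits)
    fix i j
    have pre: "Int_stable {f -` S \<inter> space M | S. S \<in> sets N}" for f :: "'w \<Rightarrow> 'b" and N :: "'b measure"
    proof (rule Int_stableI)
      fix a b assume "a \<in> {f -` S \<inter> space M | S. S \<in> sets N}" "b \<in> {f -` S \<inter> space M | S. S \<in> sets N}"
      then obtain S T where "a = f -` S \<inter> space M" "b = f -` T \<inter> space M" "S \<in> sets N" "T \<in> sets N" by blast
      then show "a \<inter> b \<in> {f -` S \<inter> space M | S. S \<in> sets N}" by (intro CollectI exI[of _ "S \<inter> T"]) auto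
    qed
    show "Int_stable (F i)" by (cases i) (simp_all add: F_def pre)
  qed
  then have indep: "indep_set (sigma_sets (space M) (\<Union>i\<le>k. F i)) (sigma_sets (space M) (F (Suc k)))"
    unfolding indep_set_def by (rule indep_sets_mono_sets) (auto simp: I_def split: bool.splits)
  have hist: "sets (history x0 k) \<subseteq> sigma_sets (space M) (\<Union>i\<le>k. F i)"
    unfolding sets_history
  proof (rule sigma_sets_mono', rule Un_least)
    show "{x0 -` S \<inter> space M |S. S \<in> sets borel} \<subseteq> (\<Union>i\<le>k. F i)"
      by (rule order_trans[OF _ UN_upper[of 0]]) (simp_all add: F_def)
    show "{w i -` S \<inter> space M |i S. i < k \<and> S \<in> sets borel} \<subseteq> (\<Union>i\<le>k. F i)"
    proof safe
      fix i and S :: "real set" assume "i < k" "S \<in> sets borel"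
      then show "w i -` S \<inter> space M \<in> (\<Union>i\<le>k. F i)" by (intro UN_I[of "Suc i"]) (auto simp: F_def)
    qed
  qed
  have "indep_set (sigma_sets (space M) {h -` A \<inter> space M | A. A \<in> sets borel})
      (sigma_sets (space M) {w k -` A \<inter> space M | A. A \<in> sets borel})"
    using indep unfolding indep_set_def
  proof (rule indep_sets_mono_sets)
    have "{h -` A \<inter> space M | A. A \<in> sets borel} \<subseteq> sets (history x0 k)"
      using measurable_sets[OF h] by auto
    then have "sigma_sets (space M) {h -` A \<inter> space M | A. A \<in> sets borel} \<subseteq> sigma_sets (space M) (\<Union>i\<le>k. F i)"
      using hist by (intro sigma_sets_mono) auto
    then show "case_bool (sigma_sets (space M) {h -` A \<inter> space M | A. A \<in> sets borel})
      (sigma_sets (space M) {w k -` A \<inter> space M | A. A \<in> sets borel}) i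
      \<subseteq> case_bool (sigma_sets (space M) (\<Union>i\<le>k. F i)) (sigma_sets (space M) (F (Suc k))) i" for i
      by (auto simp: F_def split: bool.splits)
  qed
  moreover have "h \<in> borel_measurable M"
  proof (rule measurable_sets_mono[OF h(1)])
    have x0m: "x0 \<in> borel_measurable M" by (rule initial_measurable[OF x0])
    show "sets (history x0 k) \<subseteq> sets M"
      unfolding sets_history
      by (rule sets.sigma_sets_subset) (auto intro!: measurable_sets[OF x0m] measurable_sets[OF w_measurable])
  qed simp
  ultimately show ?thesis unfolding indep_var_eq by simp
qed

lemma noise_moments:
  assumes x0: "initial_state M w x0" and h: "h \<in> borel_measurable (history x0 k)" "integrable M h"
  shows "integrable M (\<lambda>\<omega>. w k \<omega> * h \<omega>)" "(\<integral>\<omega>. w k \<omega> * h \<omega> \<partial>M) = 0"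
    and "integrable M (\<lambda>\<omega>. (w k \<omega>)\<^sup>2 * h \<omega>)" "(\<integral>\<omega>. (w k \<omega>)\<^sup>2 * h \<omega> \<partial>M) = \<sigma>\<^sup>2 * (\<integral>\<omega>. h \<omega> \<partial>M)"
proof -
  note ind = indep_history_noise[OF x0 h(1)]
  show "integrable M (\<lambda>\<omega>. w k \<omega> * h \<omega>)" "(\<integral>\<omega>. w k \<omega> * h \<omega> \<partial>M) = 0"
    using indep_var_integrable[OF ind h(2) w_integrable] indep_var_lebesgue_integral[OF ind h(2) w_integrable]
    by (simp_all add: w_mean mult.commute)
  have "indep_var borel (id \<circ> h) borel ((\<lambda>t. t\<^sup>2) \<circ> w k)"
    by (rule indep_var_compose[OF ind]) auto
  then have ind2: "indep_var borel h borel (\<lambda>\<omega>. (w k \<omega>)\<^sup>2)" by (simp add: comp_def)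
  show "integrable M (\<lambda>\<omega>. (w k \<omega>)\<^sup>2 * h \<omega>)" "(\<integral>\<omega>. (w k \<omega>)\<^sup>2 * h \<omega> \<partial>M) = \<sigma>\<^sup>2 * (\<integral>\<omega>. h \<omega> \<partial>M)"
    using indep_var_integrable[OF ind2 h(2) w_square_integrable] indep_var_lebesgue_integral[OF ind2 h(2) w_square_integrable]
    by (simp_all add: w_second_moment mult.commute)
qed

end

section \<open>Integrability and moments of square-integrable vectors\<close>

lemma outer_mult: "outer a b *v v = (b \<bullet> v) *\<^sub>R a"
  by (simp add: vec_eq_iff outer_def matrix_vector_mult_def inner_vec_def sum_distrib_left mult_ac)

lemma bilinear_integrable:
  assumes "square_integrable M x" "square_integrable M y"
  shows "integrable M (\<lambda>\<omega>. x \<omega> \<bullet> (P *v y \<omega>))"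
proof (rule Bochner_Integration.integrable_bound)
  have [measurable]: "x \<in> borel_measurable M" "y \<in> borel_measurable M"
    using assms by (simp_all add: square_integrable_def)
  show "integrable M (\<lambda>\<omega>. norm P * (x \<omega> \<bullet> x \<omega> + y \<omega> \<bullet> y \<omega>))"
    using assms by (simp add: square_integrable_def)
  have "(\<lambda>\<omega>. P *v y \<omega>) \<in> borel_measurable M"
    by (rule measurable_compose[OF _ borel_measurable_matrix_vector_mult]) simp
  then show "(\<lambda>\<omega>. x \<omega> \<bullet> (P *v y \<omega>)) \<in> borel_measurable M" by simp
  have "\<bar>a \<bullet> (P *v b)\<bar> \<le> norm P * (a \<bullet> a + b \<bullet> b)" for a b
  proof -
    have "norm a * norm b \<le> a \<bullet> a + b \<bullet> b"
      using sum_squares_bound[of "norm a" "norm b"] mult_nonneg_nonneg[OF norm_ge_zero[of a] norm_ge_zero[of b]]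
      unfolding power2_norm_eq_inner by linarith
    then show ?thesis
      using abs_bilinear_le[of a P b] mult_left_mono[of "norm a * norm b" "a \<bullet> a + b \<bullet> b" "norm P"] by simp
  qed
  then show "AE \<omega> in M. norm (x \<omega> \<bullet> (P *v y \<omega>)) \<le> norm (norm P * (x \<omega> \<bullet> x \<omega> + y \<omega> \<bullet> y \<omega>))"
    by (simp add: abs_mult)
qed

lemma inner_integrable:
  "square_integrable M x \<Longrightarrow> square_integrable M y \<Longrightarrow> integrable M (\<lambda>\<omega>. x \<omega> \<bullet> y \<omega>)"
  using bilinear_integrable[of M x y "mat 1"] by simp

lemma quad_integrable: "square_integrable M x \<Longrightarrow> integrable M (\<lambda>\<omega>. quad P (x \<omega>))"
  unfolding quad_def by (rule bilinear_integrable)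

lemma square_integrable_matrix_mult:
  assumes "square_integrable M x"
  shows "square_integrable M (\<lambda>\<omega>. F *v x \<omega>)"
proof -
  have "(\<lambda>\<omega>. F *v x \<omega>) \<in> borel_measurable M"
    using assms by (intro measurable_compose[OF _ borel_measurable_matrix_vector_mult]) (simp add: square_integrable_def)
  moreover have "integrable M (\<lambda>\<omega>. (F *v x \<omega>) \<bullet> (F *v x \<omega>))"
    using quad_integrable[OF assms, of "transpose F ** mat 1 ** F"] by (simp only: quad_congr quad_mat_1)
  ultimately show ?thesis by (simp add: square_integrable_def)
qed

lemma square_integrable_add:
  assumes "square_integrable M x" "square_integrable M y"
  shows "square_integrable M (\<lambda>\<omega>. x \<omega> + y \<omega>)"
  using assms inner_integrable[OF assms]
  unfolding square_integrable_def by (auto simp: inner_add_left inner_add_right inner_commute)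

context prob_space
begin

lemma square_integrable_const: "square_integrable M (\<lambda>_. c)"
  by (simp add: square_integrable_def)

lemma square_integrable_imp_integrable_vec:
  fixes x :: "'a \<Rightarrow> real^'n"
  assumes "square_integrable M x"
  shows "integrable M x"
proof (rule Bochner_Integration.integrable_bound)
  show "integrable M (\<lambda>\<omega>. 1 + x \<omega> \<bullet> x \<omega>)" "x \<in> borel_measurable M"
    using assms by (simp_all add: square_integrable_def)
  have "norm v \<le> norm (1 + v \<bullet> v)" for v :: "real^'n"
    using sum_squares_bound[of 1 "norm v"] inner_ge_zero[of v] norm_ge_zero[of v]
    unfolding power2_norm_eq_inner real_norm_def one_power2 by linarith
  then show "AE \<omega> in M. norm (x \<omega>) \<le> norm (1 + x \<omega> \<bullet> x \<omega>)" by simp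
qed

lemma integral_matrix_mult:
  "integrable M x \<Longrightarrow> (\<integral>\<omega>. F *v x \<omega> \<partial>M) = F *v (\<integral>\<omega>. x \<omega> \<partial>M)"
  for F :: "real^'n^'m"
  by (rule integral_bounded_linear) simp

lemma integrable_matrix_mult:
  "integrable M x \<Longrightarrow> integrable M (\<lambda>\<omega>. F *v x \<omega>)"
  for F :: "real^'n^'m"
  by (rule integrable_bounded_linear[OF matrix_vector_mul_bounded_linear])

lemma centered:
  assumes "square_integrable M x"
  shows "square_integrable M (\<lambda>\<omega>. x \<omega> - integral\<^sup>L M x)" "(\<integral>\<omega>. x \<omega> - integral\<^sup>L M x \<partial>M) = 0"
  using square_integrable_add[OF assms square_integrable_const[of "- integral\<^sup>L M x"]]
    square_integrable_imp_integrable_vec[OF assms]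
  by (simp_all add: prob_space)

lemma integral_quad_affine:
  assumes e: "square_integrable M e" "(\<integral>\<omega>. e \<omega> \<partial>M) = 0"
  shows "(\<integral>\<omega>. quad P (F *v e \<omega> + h) \<partial>M) = (\<integral>\<omega>. quad P (F *v e \<omega>) \<partial>M) + quad P h"
proof -
  have ie: "integrable M (\<lambda>\<omega>. F *v e \<omega>)" "(\<integral>\<omega>. F *v e \<omega> \<partial>M) = 0"
    using square_integrable_imp_integrable_vec[OF e(1)] e(2)
    by (simp_all add: integrable_matrix_mult integral_matrix_mult)
  have ip: "integrable M (\<lambda>\<omega>. P *v (F *v e \<omega>))" "(\<integral>\<omega>. P *v (F *v e \<omega>) \<partial>M) = 0"
    using ie by (simp_all add: integrable_matrix_mult integral_matrix_mult)
  have expand: "quad P (a + h) = quad P a + a \<bullet> (P *v h) + h \<bullet> (P *v a) + quad P h" for a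
    by (simp add: quad_def algebra_simps inner_add_left inner_add_right)
  have "integrable M (\<lambda>\<omega>. quad P (F *v e \<omega>))"
    by (intro quad_integrable square_integrable_matrix_mult e)
  then show ?thesis
    unfolding expand using ie ip by (simp add: prob_space)
qed

text \<open>The functional called \<open>W\<close> in the overview. It is linear in \<open>p\<close>
  for square-integrable \<open>x\<close> and nonnegative on the cone, so a state acts like an
  element of the dual cone.\<close>

definition moment :: "('a \<Rightarrow> real^'n) \<Rightarrow> (real^'n^'n) \<times> (real^'n^'n) \<Rightarrow> real" where
  "moment x p = (\<integral>\<omega>. quad (fst p) (x \<omega> - integral\<^sup>L M x) \<partial>M) + quad (snd p) (integral\<^sup>L M x)"

lemma moment_add: "square_integrable M x \<Longrightarrow> moment x (p + q) = moment x p + moment x q"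
  and moment_diff: "square_integrable M x \<Longrightarrow> moment x (p - q) = moment x p - moment x q"
  by (simp_all add: moment_def quad_integrable[OF centered(1)])

lemma moment_scaleR: "moment x (c *\<^sub>R p) = c * moment x p"
  by (simp add: moment_def algebra_simps)

lemma moment_nonneg: "p \<in> nonneg_forms \<Longrightarrow> 0 \<le> moment x p"
  by (simp add: moment_def nonneg_forms_def)

lemma moment_le_unit:
  assumes "square_integrable M x"
  shows "moment x p \<le> norm p * moment x unit_forms"
  using moment_nonneg[OF forms.unit_dominates[of p], of x]
  by (simp add: moment_diff[OF assms] moment_scaleR)

lemma integral_quad:
  assumes "square_integrable M x"
  shows "(\<integral>\<omega>. quad P (F *v x \<omega> + G *v integral\<^sup>L M x) \<partial>M) =
    (\<integral>\<omega>. quad P (F *v (x \<omega> - integral\<^sup>L M x)) \<partial>M) + quad P ((F + G) *v integral\<^sup>L M x)"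
  using integral_quad_affine[OF centered[OF assms], of P F "(F + G) *v integral\<^sup>L M x"]
  by (simp add: matrix_vector_mult_add_rdistrib matrix_vector_mult_diff_distrib)

lemma second_moment_eq:
  assumes "square_integrable M x"
  shows "second_moment M x = moment x unit_forms"
  using integral_quad[OF assms, of "mat 1" "mat 1" 0]
  by (simp add: second_moment_def moment_def unit_forms_def)

end

context white_noise_space
begin

text \<open>The mean follows the drift alone, with matrix \<open>F + Fb\<close>. The new deviation
  is \<open>F\<close> applied to the old one plus \<open>w k\<close> times a vector known from the
  history; independence removes the cross terms and turns the squared noise into its variance.
  Splitting that vector again into deviation and mean gives \<open>lyap\<close>.\<close>

lemma moment_step:
  fixes x :: "'w \<Rightarrow> real^'n" and F Fb G Gb :: "real^'n^'n"
  assumes x0: "initial_state M w x0" and x: "square_integrable M x" "x \<in> borel_measurable (history x0 k)"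
    and x': "\<And>\<omega>. x' \<omega> = F *v x \<omega> + Fb *v integral\<^sup>L M x + w k \<omega> *\<^sub>R (G *v x \<omega> + Gb *v integral\<^sup>L M x)"
  shows "square_integrable M x'" "x' \<in> borel_measurable (history x0 (Suc k))"
    and "moment x' p = moment x (lyap \<sigma> F G (F + Fb) (G + Gb) p)"
proof -
  define m where "m = integral\<^sup>L M x"
  define a where "a = (\<lambda>\<omega>. F *v x \<omega> + Fb *v m)"
  define b where "b = (\<lambda>\<omega>. F *v (x \<omega> - m))"
  define y where "y = (\<lambda>\<omega>. G *v x \<omega> + Gb *v m)"
  have affine_hist: "(\<lambda>\<omega>. X *v x \<omega> + c) \<in> borel_measurable (history x0 k)" for X :: "real^'n^'n" and c
    using measurable_compose[OF x(2) borel_measurable_matrix_vector_mult[of X]] by simp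
  have a: "a \<in> borel_measurable (history x0 k)" and y: "y \<in> borel_measurable (history x0 k)"
    and b: "b \<in> borel_measurable (history x0 k)"
    using affine_hist[of F "- (F *v m)"]
    by (simp_all add: a_def y_def b_def affine_hist matrix_vector_mult_diff_distrib)
  have sq: "square_integrable M a" "square_integrable M y" "square_integrable M b"
    unfolding a_def y_def b_def m_def
    by (intro square_integrable_add square_integrable_matrix_mult square_integrable_const centered x)+
  have x'_eq: "x' = (\<lambda>\<omega>. a \<omega> + w k \<omega> *\<^sub>R y \<omega>)" by (simp add: x' a_def y_def m_def fun_eq_iff)
  have hist: "(\<lambda>\<omega>. f \<omega> \<bullet> (P *v g \<omega>)) \<in> borel_measurable (history x0 k)"
    if "f \<in> borel_measurable (history x0 k)" "g \<in> borel_measurable (history x0 k)" for f g :: "'w \<Rightarrow> real^'n" and P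
    using that(1) measurable_compose[OF that(2) borel_measurable_matrix_vector_mult[of P]] by simp
  note moments = noise_moments[OF x0]
  have int_w: "integrable M (\<lambda>\<omega>. w k \<omega> * (f \<omega> \<bullet> (P *v g \<omega>)))" "(\<integral>\<omega>. w k \<omega> * (f \<omega> \<bullet> (P *v g \<omega>)) \<partial>M) = 0"
    "integrable M (\<lambda>\<omega>. (w k \<omega>)\<^sup>2 * (f \<omega> \<bullet> (P *v g \<omega>)))"
    "(\<integral>\<omega>. (w k \<omega>)\<^sup>2 * (f \<omega> \<bullet> (P *v g \<omega>)) \<partial>M) = \<sigma>\<^sup>2 * (\<integral>\<omega>. f \<omega> \<bullet> (P *v g \<omega>) \<partial>M)"
    if "f \<in> borel_measurable (history x0 k)" "g \<in> borel_measurable (history x0 k)"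
      "square_integrable M f" "square_integrable M g" for f g :: "'w \<Rightarrow> real^'n" and P
    using moments[OF hist[OF that(1,2)] bilinear_integrable[OF that(3,4)]] by auto
  show x'_hist: "x' \<in> borel_measurable (history x0 (Suc k))"
    unfolding x'_eq using measurable_history_mono[OF a, of "Suc k"] measurable_history_mono[OF y, of "Suc k"]
      noise_measurable_history[of k "Suc k" x0] by simp
  have x'_meas: "x' \<in> borel_measurable M"
    unfolding x'_eq using sq w_measurable
    by (intro borel_measurable_add borel_measurable_scaleR) (simp_all add: square_integrable_def)
  have "integrable M (\<lambda>\<omega>. a \<omega> \<bullet> (mat 1 *v a \<omega>) + 2 * (w k \<omega> * (a \<omega> \<bullet> (mat 1 *v y \<omega>))) + (w k \<omega>)\<^sup>2 * (y \<omega> \<bullet> (mat 1 *v y \<omega>)))"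
    by (intro Bochner_Integration.integrable_add integrable_mult_right int_w bilinear_integrable sq a y)
  moreover have "x' \<omega> \<bullet> x' \<omega> = a \<omega> \<bullet> (mat 1 *v a \<omega>) + 2 * (w k \<omega> * (a \<omega> \<bullet> (mat 1 *v y \<omega>))) + (w k \<omega>)\<^sup>2 * (y \<omega> \<bullet> (mat 1 *v y \<omega>))" for \<omega>
    by (simp add: x'_eq inner_add_left inner_add_right power2_eq_square inner_commute)
  ultimately show x'_sq: "square_integrable M x'" using x'_meas by (simp add: square_integrable_def)
  have wy: "integrable M (\<lambda>\<omega>. w k \<omega> *\<^sub>R y \<omega>)"
  proof -
    have "integrable M (\<lambda>\<omega>. x' \<omega> - a \<omega>)"
      by (intro Bochner_Integration.integrable_diff square_integrable_imp_integrable_vec x'_sq sq)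
    then show ?thesis by (simp add: x'_eq)
  qed
  have wy0: "(\<integral>\<omega>. w k \<omega> *\<^sub>R y \<omega> \<partial>M) = 0"
  proof -
    \<comment> \<open>Testing the vector-valued integral against constant vectors reduces it to the
      scalar identity \<open>int_w\<close>.\<close>
    have "v \<bullet> (\<integral>\<omega>. w k \<omega> *\<^sub>R y \<omega> \<partial>M) = 0" for v
      using integral_inner_right[of v M "\<lambda>\<omega>. w k \<omega> *\<^sub>R y \<omega>"] wy
        int_w(2)[of "\<lambda>_. v" y "mat 1"] y sq by (simp add: square_integrable_const)
    then show ?thesis by (metis inner_eq_zero_iff)
  qed
  have mean: "integral\<^sup>L M x' = (F + Fb) *v m"
    unfolding x'_eq using wy wy0 square_integrable_imp_integrable_vec[OF x(1)]
    by (simp add: a_def integrable_matrix_mult integral_matrix_mult prob_space m_def matrix_vector_mult_add_rdistrib)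
  have dev: "x' \<omega> - (F + Fb) *v m = b \<omega> + w k \<omega> *\<^sub>R y \<omega>" for \<omega>
    by (simp add: x'_eq a_def b_def matrix_vector_mult_add_rdistrib matrix_vector_mult_diff_distrib)
  have expand: "quad P (b \<omega> + w k \<omega> *\<^sub>R y \<omega>) = b \<omega> \<bullet> (P *v b \<omega>) +
      (w k \<omega> * (b \<omega> \<bullet> (P *v y \<omega>)) + w k \<omega> * (y \<omega> \<bullet> (P *v b \<omega>)) + (w k \<omega>)\<^sup>2 * (y \<omega> \<bullet> (P *v y \<omega>)))" for P \<omega>
    by (simp add: quad_def matrix_vector_right_distrib matrix_vector_mult_scaleR inner_add_left inner_add_right power2_eq_square algebra_simps)
  have "(\<integral>\<omega>. quad P (b \<omega> + w k \<omega> *\<^sub>R y \<omega>) \<partial>M) = (\<integral>\<omega>. quad P (b \<omega>) \<partial>M) + \<sigma>\<^sup>2 * (\<integral>\<omega>. quad P (y \<omega>) \<partial>M)" for P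
    unfolding expand
    by (simp add: int_w[OF b y] int_w[OF y b] int_w[OF y y] sq bilinear_integrable quad_def)
  moreover have "(\<integral>\<omega>. quad P (y \<omega>) \<partial>M) = (\<integral>\<omega>. quad P (G *v (x \<omega> - m)) \<partial>M) + quad P ((G + Gb) *v m)" for P
    using integral_quad[OF x(1), of P G Gb] by (simp add: y_def m_def)
  ultimately have "moment x' p = (\<integral>\<omega>. quad (fst p) (F *v (x \<omega> - m)) \<partial>M) +
      \<sigma>\<^sup>2 * ((\<integral>\<omega>. quad (fst p) (G *v (x \<omega> - m)) \<partial>M) + quad (fst p) ((G + Gb) *v m)) + quad (snd p) ((F + Fb) *v m)"
    unfolding moment_def mean dev by (simp add: b_def)
  also have "\<dots> = moment x (lyap \<sigma> F G (F + Fb) (G + Gb) p)"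
    unfolding moment_def quad_lyap m_def[symmetric]
    by (simp add: quad_integrable square_integrable_matrix_mult centered(1)[OF x(1), folded m_def] distrib_left)
  finally show "moment x' p = moment x (lyap \<sigma> F G (F + Fb) (G + Gb) p)" .
qed

text \<open>A function of \<open>x0\<close> generates a smaller sigma-algebra, so independence from
  the noise is inherited.\<close>

lemma initial_state_compose:
  assumes x0: "initial_state M w x0" and g: "g \<in> borel_measurable borel" and sq: "square_integrable M (\<lambda>\<omega>. g (x0 \<omega>))"
  shows "initial_state M w (\<lambda>\<omega>. g (x0 \<omega>))"
proof -
  let ?W = "sets (vimage_algebra (space M) (\<lambda>\<omega> k. w k \<omega>) (Pi\<^sub>M UNIV (\<lambda>_. borel)))"
  have sub: "sets (vimage_algebra (space M) (\<lambda>\<omega>. g (x0 \<omega>)) borel) \<subseteq> sets (vimage_algebra (space M) x0 borel)"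
  proof -
    have "(\<lambda>\<omega>. g (x0 \<omega>)) -` S \<inter> space M = x0 -` (g -` S) \<inter> space M" for S by auto
    moreover have "S \<in> sets borel \<Longrightarrow> g -` S \<in> sets borel" for S
      using measurable_sets[OF g, of S] by simp
    ultimately show ?thesis unfolding sets_vimage_algebra by (intro sigma_sets_mono') blast
  qed
  have "indep_set (sets (vimage_algebra (space M) x0 borel)) ?W"
    using x0 by (simp add: initial_state_def)
  then have "indep_set (sets (vimage_algebra (space M) (\<lambda>\<omega>. g (x0 \<omega>)) borel)) ?W"
    unfolding indep_set_def by (rule indep_sets_mono_sets) (use sub in \<open>auto split: bool.splits\<close>)
  then show ?thesis using sq by (simp add: initial_state_def)
qed

text \<open>Spread one nondegenerate component of \<open>x0\<close> along \<open>v\<close>; the result is a function of \<open>x0\<close>, hence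
  still independent of the noise.\<close>

lemma rank_one_initial_states:
  fixes x0 :: "'w \<Rightarrow> real^'n"
  assumes x0: "initial_state M w x0" and nondeg: "\<not> rv_zero M (\<lambda>\<omega>. x0 \<omega> - integral\<^sup>L M x0)"
  obtains s \<eta> where "s > 0" "\<And>v :: real^'n. initial_state M w (\<lambda>\<omega>. \<eta> \<omega> *\<^sub>R v)"
    "\<And>v :: real^'n. integral\<^sup>L M (\<lambda>\<omega>. \<eta> \<omega> *\<^sub>R v) = 0"
    "\<And>(v :: real^'n) p. moment (\<lambda>\<omega>. \<eta> \<omega> *\<^sub>R v) p = s * quad (fst p) v"
proof -
  define e where "e = (\<lambda>\<omega>. x0 \<omega> - integral\<^sup>L M x0)"
  have sq: "square_integrable M x0" using x0 by (simp add: initial_state_def)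
  have e: "square_integrable M e" "integral\<^sup>L M e = 0"
    using centered[OF sq] by (simp_all add: e_def)
  have component: "(axis i 1 \<bullet> e \<omega>)\<^sup>2 = quad (outer (axis i 1) (axis i 1)) (e \<omega>)" for i \<omega>
    by (simp add: quad_def outer_mult power2_eq_square inner_commute)
  \<comment> \<open>The component variances add up to the nonzero second moment of \<open>e\<close>,
    so one of them is nonzero.\<close>
  obtain i where i: "(\<integral>\<omega>. (axis i 1 \<bullet> e \<omega>)\<^sup>2 \<partial>M) \<noteq> 0"
  proof (rule ccontr)
    assume "\<not> thesis"
    then have "(\<integral>\<omega>. (axis i 1 \<bullet> e \<omega>)\<^sup>2 \<partial>M) = 0" for i using that by blast
    moreover have "e \<omega> \<bullet> e \<omega> = (\<Sum>i\<in>UNIV. (axis i 1 \<bullet> e \<omega>)\<^sup>2)" for \<omega>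
      by (simp add: inner_vec_def[of "e \<omega>" "e \<omega>"] inner_axis' power2_eq_square)
    ultimately have "second_moment M e = 0"
      by (simp add: second_moment_def component quad_integrable[OF e(1)])
    then show False using nondeg by (simp add: rv_zero_def e_def)
  qed
  define c :: "real^'n" where "c = axis i 1"
  define s where "s = (\<integral>\<omega>. (c \<bullet> e \<omega>)\<^sup>2 \<partial>M)"
  have eta: "(c \<bullet> e \<omega>) *\<^sub>R v = outer v c *v e \<omega>" for v :: "real^'n" and \<omega> by (simp add: outer_mult)
  show thesis
  proof (rule that[of s "\<lambda>\<omega>. c \<bullet> e \<omega>"])
    have "0 \<le> s" by (simp add: s_def)
    moreover have "s \<noteq> 0" using i by (simp add: s_def c_def)
    ultimately show "0 < s" by simp
    fix v :: "real^'n"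
    show "initial_state M w (\<lambda>\<omega>. (c \<bullet> e \<omega>) *\<^sub>R v)"
      unfolding e_def
    proof (rule initial_state_compose[OF x0, of "\<lambda>z. (c \<bullet> (z - integral\<^sup>L M x0)) *\<^sub>R v"])
      show "square_integrable M (\<lambda>\<omega>. (c \<bullet> (x0 \<omega> - integral\<^sup>L M x0)) *\<^sub>R v)"
        using square_integrable_matrix_mult[OF e(1), of "outer v c"] by (simp add: outer_mult e_def)
    qed measurable
    show mean: "integral\<^sup>L M (\<lambda>\<omega>. (c \<bullet> e \<omega>) *\<^sub>R v) = 0"
      unfolding eta using integral_matrix_mult[OF square_integrable_imp_integrable_vec[OF e(1)]] e(2) by simp
    show "moment (\<lambda>\<omega>. (c \<bullet> e \<omega>) *\<^sub>R v) p = s * quad (fst p) v" for p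
      unfolding moment_def mean by (simp add: quad_scaleR_right s_def)
  qed
qed

end

section \<open>Closed loops, optimality and uniqueness\<close>

lemma scaled_tendsto_0: "s > 0 \<Longrightarrow> (\<lambda>k. s * f k) \<longlonglongrightarrow> 0 \<Longrightarrow> f \<longlonglongrightarrow> 0" for s :: real
  using tendsto_mult[of "\<lambda>_. inverse s" "inverse s" sequentially "\<lambda>k. s * f k" 0] by (simp add: mult.assoc[symmetric])

lemma bij_ex1:
  assumes "bij f"
  shows "(\<exists>!y. P y) \<longleftrightarrow> (\<exists>!x. P (f x))"
proof
  assume "\<exists>!y. P y"
  then obtain y where y: "P y" "\<And>y'. P y' \<Longrightarrow> y' = y" by blast
  obtain x where x: "y = f x" using bij_is_surj[OF assms] by (rule surjE)
  show "\<exists>!x. P (f x)"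
  proof (rule ex1I)
    show "P (f x)" using x y(1) by simp
    show "x' = x" if "P (f x')" for x'
      using y(2)[OF that] x bij_is_inj[OF assms] by (simp add: inj_eq)
  qed
next
  assume "\<exists>!x. P (f x)"
  then obtain x where x: "P (f x)" "\<And>x'. P (f x') \<Longrightarrow> x' = x" by blast
  show "\<exists>!y. P y"
  proof (rule ex1I)
    show "P (f x)" by (rule x)
    show "y = f x" if "P y" for y
    proof -
      obtain x' where "y = f x'" using bij_is_surj[OF assms] by (rule surjE)
      then show ?thesis using that x(2) by simp
    qed
  qed
qed

text \<open>\<open>S\<close> is symmetric, so once the square of \<open>S\<close> kills the stacked
  vector, the squared length of its image under \<open>S\<close> is zero.\<close>

lemma block_diag_kernel:
  fixes S :: "real^('n::finite + 'n)^('n + 'n)" and Q Qh :: "real^'n^'n"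
  assumes S: "is_psd_sqrt S (block_diag Q Qh)" and a: "Q *v a = 0" and b: "Qh *v b = 0"
  shows "S *v stack_vec a b = 0"
proof -
  have sum_split: "(\<Sum>j\<in>UNIV. f j) = (\<Sum>j\<in>UNIV. f (Inl j)) + (\<Sum>j\<in>UNIV. f (Inr j))"
    for f :: "'n + 'n \<Rightarrow> real"
    using sum.Plus[of "UNIV :: 'n set" "UNIV :: 'n set" f] by (simp add: UNIV_Plus_UNIV comp_def)
  have "(block_diag Q Qh *v stack_vec a b) $ i = 0" for i
    using a b by (cases i) (simp_all add: matrix_vector_mult_def block_diag_def stack_vec_def sum_split vec_eq_iff)
  then have "block_diag Q Qh *v stack_vec a b = 0" by (simp add: vec_eq_iff)
  then have "S *v (S *v stack_vec a b) = 0"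
    using S by (simp add: is_psd_sqrt_def matrix_vector_mul_assoc)
  moreover have "(S *v stack_vec a b) \<bullet> (S *v stack_vec a b) = stack_vec a b \<bullet> (S *v (S *v stack_vec a b))"
    using S symmetric_inner[of S "S *v stack_vec a b" "stack_vec a b"]
    by (simp add: is_psd_sqrt_def pos_semidef_def)
  ultimately show ?thesis by simp
qed

context white_noise_space
begin

lemma initial_state_const: "initial_state M w x0 \<Longrightarrow> initial_state M w (\<lambda>_. c)"
  by (rule initial_state_compose[of x0 "\<lambda>_. c"]) (simp_all add: square_integrable_const)

lemma moment_const: "moment (\<lambda>_. c) p = quad (snd p) c"
  by (simp add: moment_def prob_space)

end

text \<open>The last assumption makes initial deviations available. If all initial states were
  almost surely constant, trajectories would test the first form only through the noise.\<close>

locale mean_field_system =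
  white_noise_space M w \<sigma> + mean_field_lq \<sigma> A Ab C Cb Q Qb B Bb D Db R Rb
  for M :: "'w measure" and w \<sigma>
    and A Ab C Cb Q Qb :: "real^'n^'n" and B Bb D Db :: "real^'m^'n" and R Rb :: "real^'m^'m" +
  assumes nondegenerate: "\<exists>x0 :: 'w \<Rightarrow> real^'n. initial_state M w x0 \<and>
     \<not> rv_zero M (\<lambda>\<omega>. x0 \<omega> - integral\<^sup>L M x0)"
begin

abbreviation loop where
  "loop \<equiv> closed_loop M w A Ab B Bb C Cb D Db"

lemma feedback_moments:
  assumes "linear_feedback M L Lb x u" "square_integrable M (x k)"
  shows "square_integrable M (u k)" "integral\<^sup>L M (u k) = (L k + Lb k) *v integral\<^sup>L M (x k)"
proof -
  have u: "u k = (\<lambda>\<omega>. L k *v x k \<omega> + Lb k *v integral\<^sup>L M (x k))"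
    using assms(1) by (simp add: linear_feedback_def fun_eq_iff)
  show "square_integrable M (u k)"
    unfolding u by (intro square_integrable_add square_integrable_matrix_mult square_integrable_const assms)
  show "integral\<^sup>L M (u k) = (L k + Lb k) *v integral\<^sup>L M (x k)"
    using square_integrable_imp_integrable_vec[OF assms(2)]
    by (simp add: u integrable_matrix_mult integral_matrix_mult prob_space matrix_vector_mult_add_rdistrib)
qed

text \<open>Substituting the feedback and its mean eliminates the control and gives the shape
  required by \<open>moment_step\<close>.\<close>

lemma closed_loop_step:
  assumes cl: "loop L Lb x u" and x: "square_integrable M (x k)"
  shows "x (Suc k) \<omega> = (A + B ** L k) *v x k \<omega> + (Ab + B ** Lb k + Bb ** (L k + Lb k)) *v integral\<^sup>L M (x k) +
    w k \<omega> *\<^sub>R ((C + D ** L k) *v x k \<omega> + (Cb + D ** Lb k + Db ** (L k + Lb k)) *v integral\<^sup>L M (x k))"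
proof -
  have fb: "linear_feedback M L Lb x u" using cl by (simp add: closed_loop_def)
  have u: "u k \<omega> = L k *v x k \<omega> + Lb k *v integral\<^sup>L M (x k)"
    using fb by (simp add: linear_feedback_def)
  have sys: "x (Suc k) \<omega> =
        (A *v x k \<omega> + Ab *v (integral\<^sup>L M (x k)) + B *v u k \<omega> + Bb *v (integral\<^sup>L M (u k))) +
        w k \<omega> *\<^sub>R
        (C *v x k \<omega> + Cb *v (integral\<^sup>L M (x k)) + D *v u k \<omega> + Db *v (integral\<^sup>L M (u k)))"
    using cl unfolding closed_loop_def mf_system_def by blast
  show ?thesis
    unfolding sys feedback_moments(2)[OF fb x] unfolding u
    by (simp add: matrix_vector_mult_add_rdistrib matrix_vector_right_distrib matrix_vector_mul_assoc[symmetric] algebra_simps)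
qed

lemma closed_loop_gain_sums:
  "A + B ** L + (Ab + B ** Lb + Bb ** (L + Lb)) = A + Ab + (B + Bb) ** (L + Lb)"
  "C + D ** L + (Cb + D ** Lb + Db ** (L + Lb)) = C + Cb + (D + Db) ** (L + Lb)"
  by (simp_all add: matrix_add_ldistrib matrix_add_rdistrib)

lemma closed_loop_adapted:
  assumes cl: "loop L Lb x u"
  shows "square_integrable M (x k) \<and> x k \<in> borel_measurable (history (x 0) k)"
proof (induction k)
  case 0
  show ?case using cl by (simp add: closed_loop_def initial_state_def initial_measurable_history)
next
  case (Suc k)
  then have x: "square_integrable M (x k)" "x k \<in> borel_measurable (history (x 0) k)" by simp_all
  have "initial_state M w (x 0)" using cl by (simp add: closed_loop_def)
  from moment_step(1,2)[OF this x closed_loop_step[OF cl x(1)]] show ?case ..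
qed

lemma closed_loop_moment:
  assumes cl: "loop L Lb x u"
  shows "moment (x (Suc k)) p = moment (x k) (step (L k) (L k + Lb k) p)"
proof -
  note x = closed_loop_adapted[OF cl, of k, THEN conjunct1] closed_loop_adapted[OF cl, of k, THEN conjunct2]
  have "initial_state M w (x 0)" using cl by (simp add: closed_loop_def)
  from moment_step(3)[OF this x closed_loop_step[OF cl x(1)], of p]
  show ?thesis by (simp only: closed_loop_gain_sums step_def)
qed

lemma closed_loop_moment_funpow:
  assumes cl: "loop (\<lambda>_. L) (\<lambda>_. Lb) x u"
  shows "moment (x k) p = moment (x 0) ((step L (L + Lb) ^^ k) p)"
  by (induction k arbitrary: p) (simp_all add: closed_loop_moment[OF cl] funpow_swap1)

lemma closed_loop_second_moment:
  assumes cl: "loop (\<lambda>_. L) (\<lambda>_. Lb) x u"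
  shows "second_moment M (x k) = moment (x 0) ((step L (L + Lb) ^^ k) unit_forms)"
  by (rule trans[OF second_moment_eq closed_loop_moment_funpow[OF cl]]) (simp add: closed_loop_adapted[OF cl])

lemma closed_loop_control_measurable:
  assumes cl: "loop L Lb x u"
  shows "u k \<in> borel_measurable (past_info M (x 0) w k)"
proof (rule measurable_history_past_info)
  have u: "u k = (\<lambda>\<omega>. L k *v x k \<omega> + Lb k *v integral\<^sup>L M (x k))"
    using cl by (simp add: closed_loop_def linear_feedback_def fun_eq_iff)
  show "u k \<in> borel_measurable (history (x 0) k)"
    unfolding u
    by (intro borel_measurable_add borel_measurable_const
        measurable_compose[OF closed_loop_adapted[OF cl, THEN conjunct2] borel_measurable_matrix_vector_mult])
qed

lemma closed_loop_stage_cost: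
  assumes cl: "loop L Lb x u"
  shows "(\<integral>\<omega>. (x k \<omega> \<bullet> (Q *v x k \<omega>) + integral\<^sup>L M (x k) \<bullet> (Qb *v integral\<^sup>L M (x k)) +
        u k \<omega> \<bullet> (R *v u k \<omega>) + integral\<^sup>L M (u k) \<bullet> (Rb *v integral\<^sup>L M (u k))) \<partial>M)
      = moment (x k) (cost (L k) (L k + Lb k))"
proof -
  have x: "square_integrable M (x k)" by (rule closed_loop_adapted[OF cl, THEN conjunct1])
  have fb: "linear_feedback M L Lb x u" using cl by (simp add: closed_loop_def)
  have u: "u k = (\<lambda>\<omega>. L k *v x k \<omega> + Lb k *v integral\<^sup>L M (x k))"
    using fb by (simp add: linear_feedback_def fun_eq_iff)
  define m where "m = integral\<^sup>L M (x k)"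
  have e: "square_integrable M (\<lambda>\<omega>. x k \<omega> - m)" using centered(1)[OF x] by (simp add: m_def)
  have Qx: "(\<integral>\<omega>. quad Q (x k \<omega>) \<partial>M) = (\<integral>\<omega>. quad Q (x k \<omega> - m) \<partial>M) + quad Q m"
    using integral_quad[OF x, of Q "mat 1" 0] by (simp add: m_def)
  have Ru: "(\<integral>\<omega>. quad R (u k \<omega>) \<partial>M) = (\<integral>\<omega>. quad R (L k *v (x k \<omega> - m)) \<partial>M) + quad R ((L k + Lb k) *v m)"
    using integral_quad[OF x, of R "L k" "Lb k"] by (simp add: u m_def)
  have "(\<integral>\<omega>. quad Q (x k \<omega>) + quad Qb m + quad R (u k \<omega>) + quad Rb ((L k + Lb k) *v m) \<partial>M)
      = moment (x k) (cost (L k) (L k + Lb k))"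
    by (simp add: Qx Ru prob_space moment_def cost_def m_def[symmetric]
        quad_integrable square_integrable_matrix_mult x e feedback_moments(1)[OF fb x])
  then show ?thesis
    unfolding feedback_moments(2)[OF fb x] by (simp add: quad_def m_def)
qed

text \<open>Stabilisation quantifies over trajectories, so a trajectory from each initial state is
  what makes it yield a decay statement.\<close>

lemma closed_loop_exists:
  assumes "initial_state M w x0"
  obtains x u where "loop L Lb x u" "x 0 = x0"
proof -
  define F where "F k X = (\<lambda>\<omega>. L k *v X \<omega> + Lb k *v integral\<^sup>L M X)" for k and X :: "'w \<Rightarrow> real^'n"
  define x where "x = rec_nat x0 (\<lambda>k X \<omega>.
    (A *v X \<omega> + Ab *v (integral\<^sup>L M X) + B *v F k X \<omega> + Bb *v (integral\<^sup>L M (F k X))) +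
        w k \<omega> *\<^sub>R (C *v X \<omega> + Cb *v (integral\<^sup>L M X) + D *v F k X \<omega> + Db *v (integral\<^sup>L M (F k X))))"
  have "loop L Lb x (\<lambda>k. F k (x k))"
    using assms unfolding closed_loop_def mf_system_def linear_feedback_def by (simp add: x_def) (simp add: F_def)
  then show thesis by (rule that) (simp add: x_def)
qed

lemma free_exists:
  assumes x0: "initial_state M w x0"
  obtains x where "x 0 = x0"
    "\<And>k \<omega>. x (Suc k) \<omega> = (A *v x k \<omega> + Ab *v (integral\<^sup>L M (x k))) + w k \<omega> *\<^sub>R (C *v x k \<omega> + Cb *v (integral\<^sup>L M (x k)))"
    "\<And>k. second_moment M (x k) = moment x0 ((free ^^ k) unit_forms)"
proof -
  define x where "x = rec_nat x0 (\<lambda>k X \<omega>.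
    (A *v X \<omega> + Ab *v (integral\<^sup>L M X)) + w k \<omega> *\<^sub>R (C *v X \<omega> + Cb *v (integral\<^sup>L M X)))"
  have [simp]: "x 0 = x0" by (simp add: x_def)
  have Suc: "x (Suc k) \<omega> = A *v x k \<omega> + Ab *v (integral\<^sup>L M (x k)) + w k \<omega> *\<^sub>R (C *v x k \<omega> + Cb *v (integral\<^sup>L M (x k)))" for k \<omega>
    by (simp add: x_def)
  have inv: "square_integrable M (x k) \<and> x k \<in> borel_measurable (history x0 k)" for k
  proof (induction k)
    case 0
    show ?case using x0 by (simp add: initial_state_def initial_measurable_history)
  next
    case (Suc k)
    then show ?case using moment_step(1,2)[OF x0 _ _ \<open>\<And>\<omega>. x (Suc k) \<omega> = _\<close>] by simp
  qed
  have "moment (x k) p = moment x0 ((free ^^ k) p)" for k p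
  proof (induction k arbitrary: p)
    case (Suc k)
    have "moment (x (Suc k)) p = moment (x k) (free p)"
      using moment_step(3)[OF x0 _ _ \<open>\<And>\<omega>. x (Suc k) \<omega> = _\<close>] inv[of k] by (simp add: free_def)
    then show ?case by (simp add: Suc funpow_swap1)
  qed simp
  then show thesis using inv Suc by (intro that[of x]) (simp_all add: second_moment_eq)
qed

text \<open>Centred states along \<open>v\<close> read off the first form and constant states the
  second; together they turn statements about all initial states into statements about both
  forms.\<close>

lemma moment_test_states:
  obtains s and y :: "real^'n \<Rightarrow> 'w \<Rightarrow> real^'n" where "s > 0"
    "\<And>v. initial_state M w (y v)" "\<And>v. initial_state M w (\<lambda>_. v)"
    "\<And>v p. moment (y v) p = s * quad (fst p) v"
    "\<And>v. integral\<^sup>L M (y v) = 0" "\<And>v \<omega>. \<exists>t. y v \<omega> = t *\<^sub>R v"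
proof -
  obtain x0 :: "'w \<Rightarrow> real^'n" where x0: "initial_state M w x0" "\<not> rv_zero M (\<lambda>\<omega>. x0 \<omega> - integral\<^sup>L M x0)"
    using nondegenerate by blast
  obtain s \<eta> where "s > 0" "\<And>v :: real^'n. initial_state M w (\<lambda>\<omega>. \<eta> \<omega> *\<^sub>R v)"
    "\<And>v :: real^'n. integral\<^sup>L M (\<lambda>\<omega>. \<eta> \<omega> *\<^sub>R v) = 0"
    "\<And>(v :: real^'n) p. moment (\<lambda>\<omega>. \<eta> \<omega> *\<^sub>R v) p = s * quad (fst p) v"
    by (rule rank_one_initial_states[OF x0], rule that)
  then show thesis
    by (intro that[of s "\<lambda>v \<omega>. \<eta> \<omega> *\<^sub>R v"]) (auto intro: initial_state_const[OF x0(1)])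
qed

text \<open>Test states with values in the kernel of \<open>Q\<close>, and constant states in the
  kernel of \<open>Q + Qb\<close>, have zero output at time 0.\<close>

lemma detectable:
  assumes S: "is_psd_sqrt S (block_diag Q (Q + Qb))" and det: "exactly_detectable M w A Ab C Cb S"
  shows detectable_forms
proof -
  obtain s and y :: "real^'n \<Rightarrow> 'w \<Rightarrow> real^'n" where s: "s > 0"
    and y: "\<And>v. initial_state M w (y v)" "\<And>v. initial_state M w (\<lambda>_. v :: real^'n)"
    and mom: "\<And>v p. moment (y v) p = s * quad (fst p) v"
    and y0: "\<And>v. integral\<^sup>L M (y v) = 0" "\<And>v \<omega>. \<exists>t. y v \<omega> = t *\<^sub>R v"
    by (rule moment_test_states, rule that)
  have decay: "(\<lambda>k. moment x0 ((free ^^ k) unit_forms)) \<longlonglongrightarrow> 0"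
    if x0: "initial_state M w x0" and Y: "\<And>\<omega>. Q *v (x0 \<omega> - integral\<^sup>L M x0) = 0" "(Q + Qb) *v integral\<^sup>L M x0 = 0" for x0
  proof -
    obtain x where x: "x 0 = x0"
      "\<And>k \<omega>. x (Suc k) \<omega> = (A *v x k \<omega> + Ab *v (integral\<^sup>L M (x k))) + w k \<omega> *\<^sub>R (C *v x k \<omega> + Cb *v (integral\<^sup>L M (x k)))"
      "\<And>k. second_moment M (x k) = moment x0 ((free ^^ k) unit_forms)"
      using free_exists[OF x0] by blast
    have "rv_zero M (\<lambda>\<omega>. S *v stack_vec (x0 \<omega> - integral\<^sup>L M x0) (integral\<^sup>L M x0))"
      by (simp add: block_diag_kernel[OF S Y(1) Y(2)] rv_zero_def second_moment_def)
    \<comment> \<open>Detectability is taken with \<open>N = 0\<close>, so only the output at time 0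
      has to vanish.\<close>
    then have "(\<lambda>k. second_moment M (x k)) \<longlonglongrightarrow> 0"
      using det x0 x(1,2) unfolding exactly_detectable_def by (metis le_zero_eq)
    then show ?thesis by (simp only: x(3))
  qed
  show ?thesis
    unfolding detectable_forms_def
  proof (intro conjI allI impI)
    fix a assume a: "Q *v a = 0"
    have "Q *v (y a \<omega>) = 0" for \<omega>
      using y0(2)[of a \<omega>] a by (auto simp: matrix_vector_mult_scaleR)
    then have "(\<lambda>k. s * quad (fst ((free ^^ k) unit_forms)) a) \<longlonglongrightarrow> 0"
      using decay[OF y(1)[of a]] by (simp add: y0(1) mom)
    then show "(\<lambda>k. quad (fst ((free ^^ k) unit_forms)) a) \<longlonglongrightarrow> 0" by (rule scaled_tendsto_0[OF s])
  next
    fix a assume "(Q + Qb) *v a = 0"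
    then show "(\<lambda>k. quad (snd ((free ^^ k) unit_forms)) a) \<longlonglongrightarrow> 0"
      using decay[OF y(2)[of a]] by (simp add: moment_const prob_space)
  qed
qed

section \<open>Mean square stability as summability of orbits of forms\<close>

abbreviation stabilizing_gains where
  "stabilizing_gains \<equiv> stabilizing M w A Ab B Bb C Cb D Db"

text \<open>The orbit theorem is applied with cost and Lyapunov element both 0; its detectability
  premise then asks for decay under every dual functional. Stabilisation supplies this through the
  test states, and plain convergence to 0 improves to summability.\<close>

lemma stabilizing_imp_summable:
  assumes stab: "stabilizing_gains (\<lambda>_. L) (\<lambda>_. Lb)" and z: "z \<in> forms.dual_cone"
  shows "summable (\<lambda>k. z \<bullet> (step L (L + Lb) ^^ k) unit_forms)"
proof (rule forms.summable_orbit[OF linear_step step_nonneg, of 0 0])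
  obtain s and y :: "real^'n \<Rightarrow> 'w \<Rightarrow> real^'n" where s: "s > 0"
    and y: "\<And>v. initial_state M w (y v)" "\<And>v. initial_state M w (\<lambda>_. v :: real^'n)"
    and mom: "\<And>v p. moment (y v) p = s * quad (fst p) v"
    and y0: "\<And>v. integral\<^sup>L M (y v) = 0" "\<And>v \<omega>. \<exists>t. y v \<omega> = t *\<^sub>R v"
    by (rule moment_test_states, rule that)
  let ?p = "\<lambda>k. (step L (L + Lb) ^^ k) unit_forms"
  have decay: "(\<lambda>k. moment x0 (?p k)) \<longlonglongrightarrow> 0" if x0: "initial_state M w x0" for x0
  proof -
    obtain x u where cl: "loop (\<lambda>_. L) (\<lambda>_. Lb) x u" and [simp]: "x 0 = x0"
      using closed_loop_exists[OF x0] by blast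
    have "(\<lambda>k. second_moment M (x k)) \<longlonglongrightarrow> 0" using stab cl unfolding stabilizing_def by blast
    then show ?thesis
      by (simp add: closed_loop_second_moment[OF cl])
  qed
  have sym: "symmetric_pair (?p k)" for k
    unfolding step_def by (rule symmetric_lyap_funpow[OF symmetric_unit])
  have "(\<lambda>k. fst (?p k)) \<longlonglongrightarrow> 0"
    using sym scaled_tendsto_0[OF s] decay[OF y(1)] by (intro symmetric_tendsto_0) (auto simp: mom symmetric_pair_def)
  moreover have "(\<lambda>k. snd (?p k)) \<longlonglongrightarrow> 0"
    using sym decay[OF y(2)] by (intro symmetric_tendsto_0) (auto simp: moment_const symmetric_pair_def)
  ultimately have "(\<lambda>k. (fst (?p k), snd (?p k))) \<longlonglongrightarrow> (0, 0)" by (rule tendsto_Pair)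
  then have "?p \<longlonglongrightarrow> 0" by (simp add: zero_prod_def)
  then show "(\<lambda>j. Z \<bullet> ?p j) \<longlonglongrightarrow> 0" for Z
    using tendsto_inner[OF tendsto_const, of ?p 0 sequentially Z] by simp
qed (use z linear_0[OF linear_step] in \<open>simp_all add: nonneg_forms_def\<close>)

text \<open>Terms of a summable orbit tend to 0 on rank-one functionals, hence in norm, and the
  second moment is at most that norm times the initial second moment.\<close>

lemma summable_imp_stabilizing:
  assumes summable: "\<And>z. z \<in> forms.dual_cone \<Longrightarrow> summable (\<lambda>k. z \<bullet> (step L (L + Lb) ^^ k) unit_forms)"
  shows "stabilizing_gains (\<lambda>_. L) (\<lambda>_. Lb)"
  unfolding stabilizing_def
proof (intro allI impI conjI)
  fix x u k assume cl: "loop (\<lambda>_. L) (\<lambda>_. Lb) x u"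
  show "u k \<in> borel_measurable (past_info M (x 0) w k)" by (rule closed_loop_control_measurable[OF cl])
  let ?p = "\<lambda>k. (step L (L + Lb) ^^ k) unit_forms"
  have sym: "symmetric_pair (?p k)" for k
    unfolding step_def by (rule symmetric_lyap_funpow[OF symmetric_unit])
  have "(\<lambda>k. fst (?p k)) \<longlonglongrightarrow> 0" "(\<lambda>k. snd (?p k)) \<longlonglongrightarrow> 0"
    using sym summable_LIMSEQ_zero[OF summable[OF outer_dual(1)]] summable_LIMSEQ_zero[OF summable[OF outer_dual(2)]]
    by (intro symmetric_tendsto_0; auto simp: symmetric_pair_def inner_outer_fst inner_outer_snd)+
  then have "(\<lambda>k. (fst (?p k), snd (?p k))) \<longlonglongrightarrow> (0, 0)" by (rule tendsto_Pair)
  then have "?p \<longlonglongrightarrow> 0" by (simp add: zero_prod_def)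
  then have lim: "(\<lambda>k. norm (?p k) * moment (x 0) unit_forms) \<longlonglongrightarrow> 0"
    using tendsto_mult[OF tendsto_norm tendsto_const, of ?p 0 sequentially "moment (x 0) unit_forms"] by simp
  have x: "square_integrable M (x 0)" by (rule closed_loop_adapted[OF cl, THEN conjunct1])
  show "(\<lambda>k. second_moment M (x k)) \<longlonglongrightarrow> 0"
    unfolding closed_loop_second_moment[OF cl]
    by (rule tendsto_sandwich[OF _ _ tendsto_const lim])
      (simp_all add: moment_nonneg moment_le_unit[OF x] step_funpow_nonneg forms.unit_in_cone)
qed

lemma fixpoint_imp_stabilizing:
  assumes "detectable_forms" "psd_pair p" "Ric p = p"
  shows "stabilizing_gains (\<lambda>_. K_dev p) (\<lambda>_. K_avg p - K_dev p)"
  by (rule summable_imp_stabilizing) (use fixpoint_gain_stable[OF assms] in simp)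

section \<open>Costs, optimality and uniqueness\<close>

lemma closed_loop_cost:
  assumes cl: "loop L Lb x u"
  shows "(\<lambda>N. ereal (\<Sum>k<N. moment (x k) (cost (L k) (L k + Lb k)))) \<longlonglongrightarrow> mf_cost M Q Qb R Rb x u"
proof -
  have "mf_cost M Q Qb R Rb x u = (\<Sum>k. ereal (moment (x k) (cost (L k) (L k + Lb k))))"
    unfolding mf_cost_def closed_loop_stage_cost[OF cl] ..
  moreover have "(\<lambda>N. \<Sum>k<N. ereal (moment (x k) (cost (L k) (L k + Lb k)))) \<longlonglongrightarrow> (\<Sum>k. ereal (moment (x k) (cost (L k) (L k + Lb k))))"
    by (intro summable_LIMSEQ summable_ereal_pos) (simp add: moment_nonneg cost_nonneg)
  ultimately show ?thesis by (simp only: sum_ereal)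
qed

text \<open>Mean square stability removes the terminal term of the telescoped value, because the
  second moment dominates \<open>moment\<close> up to \<open>norm p\<close>.\<close>

lemma value_tendsto:
  assumes cl: "loop L Lb x u" and stab: "stabilizing_gains L Lb" and p: "p \<in> nonneg_forms"
  shows "(\<lambda>N. ereal (moment (x 0) p - moment (x N) p)) \<longlonglongrightarrow> ereal (moment (x 0) p)"
proof -
  have x: "square_integrable M (x k)" for k by (rule closed_loop_adapted[OF cl, THEN conjunct1])
  have "(\<lambda>k. second_moment M (x k)) \<longlonglongrightarrow> 0" using stab cl unfolding stabilizing_def by blast
  then have lim: "(\<lambda>k. norm p * moment (x k) unit_forms) \<longlonglongrightarrow> 0"
    using tendsto_mult[OF tendsto_const, of _ 0 sequentially "norm p"] by (simp add: second_moment_eq[OF x])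
  have "(\<lambda>k. moment (x k) p) \<longlonglongrightarrow> 0"
    by (rule tendsto_sandwich[OF _ _ tendsto_const lim]) (simp_all add: moment_nonneg p moment_le_unit[OF x])
  then show ?thesis using tendsto_diff[OF tendsto_const, of "\<lambda>N. moment (x N) p" 0 sequentially "moment (x 0) p"] by simp
qed

text \<open>\<open>Ric_le_step\<close> holds for every gain, so it can be used at each time with the
  gains of that time and then summed; this covers time-varying competitors.\<close>

lemma cost_lower_bound:
  assumes cl: "loop L Lb x u" and stab: "stabilizing_gains L Lb" and p: "psd_pair p" "Ric p = p"
  shows "ereal (moment (x 0) p) \<le> mf_cost M Q Qb R Rb x u"
proof (rule LIMSEQ_le[OF value_tendsto[OF cl stab] closed_loop_cost[OF cl]])
  show "p \<in> nonneg_forms" using p by (simp add: psd_pair_def)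
  have x: "square_integrable M (x k)" for k by (rule closed_loop_adapted[OF cl, THEN conjunct1])
  have step: "moment (x k) p - moment (x (Suc k)) p \<le> moment (x k) (cost (L k) (L k + Lb k))" for k
    using moment_nonneg[OF Ric_le_step[OF p(1), of "L k" "L k + Lb k"], of "x k"]
    by (simp add: p(2) moment_add[OF x] moment_diff[OF x] closed_loop_moment[OF cl])
  have "moment (x 0) p - moment (x N) p \<le> (\<Sum>k<N. moment (x k) (cost (L k) (L k + Lb k)))" for N
    unfolding sum_lessThan_telescope'[of "\<lambda>k. moment (x k) p" N, symmetric] by (intro sum_mono step)
  then show "\<exists>N. \<forall>n\<ge>N. ereal (moment (x 0) p - moment (x n) p) \<le> ereal (\<Sum>k<n. moment (x k) (cost (L k) (L k + Lb k)))"
    by simp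
qed

lemma optimal_cost:
  assumes det: detectable_forms and p: "psd_pair p" "Ric p = p"
    and cl: "loop (\<lambda>_. K_dev p) (\<lambda>_. K_avg p - K_dev p) x u"
  shows "mf_cost M Q Qb R Rb x u = ereal (moment (x 0) p)"
proof (rule LIMSEQ_unique[OF closed_loop_cost[OF cl]])
  have x: "square_integrable M (x k)" for k by (rule closed_loop_adapted[OF cl, THEN conjunct1])
  have eq: "p = cost (K_dev p) (K_avg p) + step (K_dev p) (K_avg p) p"
    using Ric_eq_step[OF p(1)] p(2) by simp
  have "moment (x k) (cost (K_dev p) (K_avg p)) = moment (x k) p - moment (x (Suc k)) p" for k
    using arg_cong[OF eq, of "moment (x k)"] by (simp add: moment_add[OF x] closed_loop_moment[OF cl])
  then have "(\<Sum>k<N. moment (x k) (cost (K_dev p) (K_avg p))) = moment (x 0) p - moment (x N) p" for N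
    using sum_lessThan_telescope'[of "\<lambda>k. moment (x k) p" N] by simp
  then show "(\<lambda>N. ereal (\<Sum>k<N. moment (x k) (cost (K_dev p) (K_dev p + (K_avg p - K_dev p))))) \<longlonglongrightarrow> ereal (moment (x 0) p)"
    using value_tendsto[OF cl fixpoint_imp_stabilizing[OF det p]] p by (simp add: psd_pair_def)
qed

lemma fixpoint_unique:
  assumes det: detectable_forms
    and p: "psd_pair p" "Ric p = p" and q: "psd_pair q" "Ric q = q"
  shows "p = q"
proof -
  obtain s and y :: "real^'n \<Rightarrow> 'w \<Rightarrow> real^'n" where s: "s > 0"
    and y: "\<And>v. initial_state M w (y v)" "\<And>v. initial_state M w (\<lambda>_. v :: real^'n)"
    and mom: "\<And>v p. moment (y v) p = s * quad (fst p) v"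
    and y0: "\<And>v. integral\<^sup>L M (y v) = 0" "\<And>v \<omega>. \<exists>t. y v \<omega> = t *\<^sub>R v"
    by (rule moment_test_states, rule that)
  \<comment> \<open>The feedback of \<open>p\<close> is stabilising and its cost is given by
    \<open>p\<close>, while \<open>q\<close> bounds the cost of every stabilising feedback from
    below.\<close>
  have le: "moment x0 q \<le> moment x0 p"
    if x0: "initial_state M w x0" and p: "psd_pair p" "Ric p = p" and q: "psd_pair q" "Ric q = q" for x0 p q
  proof -
    obtain x u where cl: "loop (\<lambda>_. K_dev p) (\<lambda>_. K_avg p - K_dev p) x u" and "x 0 = x0"
      using closed_loop_exists[OF x0] by blast
    then show ?thesis
      using cost_lower_bound[OF cl fixpoint_imp_stabilizing[OF det p] q] optimal_cost[OF det p cl] by simp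
  qed
  have eq: "moment x0 p = moment x0 q" if "initial_state M w x0" for x0
    using le[OF that p q] le[OF that q p] by simp
  show ?thesis
  proof (rule prod_eqI; rule symmetric_quad_eqI)
    show "quad (fst p) v = quad (fst q) v" for v using eq[OF y(1)[of v]] s by (simp add: mom)
    show "quad (snd p) v = quad (snd q) v" for v using eq[OF y(2)[of v]] by (simp add: moment_const)
  qed (use p q in \<open>auto simp: psd_pair_def symmetric_pair_def\<close>)
qed

lemma moment_initial:
  assumes "initial_state M w x0"
  shows "moment x0 (P, P + Pb) = (\<integral>\<omega>. x0 \<omega> \<bullet> (P *v x0 \<omega>) \<partial>M) + integral\<^sup>L M x0 \<bullet> (Pb *v integral\<^sup>L M x0)"
  using integral_quad[of x0 P "mat 1" 0] assms
  by (simp add: moment_def initial_state_def quad_def[symmetric])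

lemma stabilizable_iff_fixpoint:
  assumes det: detectable_forms
  shows "ms_stabilizable M w A Ab B Bb C Cb D Db \<longleftrightarrow> (\<exists>!p. psd_pair p \<and> Ric p = p)"
proof
  assume "ms_stabilizable M w A Ab B Bb C Cb D Db"
  then obtain L Lb where stab: "stabilizing_gains (\<lambda>_. L) (\<lambda>_. Lb)"
    unfolding ms_stabilizable_def by blast
  have "\<exists>p. psd_pair p \<and> Ric p = p"
    by (rule Ric_fixpoint_exists, erule stabilizing_imp_summable[OF stab], blast)
  then show "\<exists>!p. psd_pair p \<and> Ric p = p" using fixpoint_unique[OF det] by blast
next
  assume "\<exists>!p. psd_pair p \<and> Ric p = p"
  then show "ms_stabilizable M w A Ab B Bb C Cb D Db"
    using fixpoint_imp_stabilizing[OF det] unfolding ms_stabilizable_def by blast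
qed

end

theorem theorem5:
  fixes M :: "'w measure" and w :: "nat \<Rightarrow> 'w \<Rightarrow> real" and \<sigma> :: real
    and A Ab C Cb Q Qb :: "real^'n^'n"
    and B Bb D Db :: "real^'m^'n"
    and R Rb :: "real^'m^'m"
    and S :: "real^('n + 'n)^('n + 'n)"
  assumes "prob_space M" and "white_noise M w \<sigma>"
    and "\<exists>x0 :: 'w \<Rightarrow> real^'n. initial_state M w x0 \<and>
           \<not> rv_zero M (\<lambda>\<omega>. x0 \<omega> - integral\<^sup>L M x0)"
    and "transpose Q = Q" "transpose Qb = Qb" "transpose R = R" "transpose Rb = Rb"
    and "pos_def R" "pos_def (R + Rb)" "pos_semidef Q" "pos_semidef (Q + Qb)"
    and "is_psd_sqrt S (block_diag Q (Q + Qb))"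
    and "exactly_detectable M w A Ab C Cb S"
  shows "(ms_stabilizable M w A Ab B Bb C Cb D Db \<longleftrightarrow>
            (\<exists>!X. case X of (P, Pb) \<Rightarrow> riccati_solution \<sigma> A Ab B Bb C Cb D Db Q Qb R Rb P Pb)) \<and>
         (ms_stabilizable M w A Ab B Bb C Cb D Db \<longrightarrow>
            (\<forall>P Pb. riccati_solution \<sigma> A Ab B Bb C Cb D Db Q Qb R Rb P Pb \<longrightarrow>
               (let K = gain_K \<sigma> A B C D R P;
                    Kb = gain_Kb \<sigma> A Ab B Bb C Cb D Db R Rb P Pb
                in stabilizing M w A Ab B Bb C Cb D Db (\<lambda>_. K) (\<lambda>_. Kb) \<and>
                   (\<forall>x u. closed_loop M w A Ab B Bb C Cb D Db (\<lambda>_. K) (\<lambda>_. Kb) x u \<longrightarrow>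
                      (\<forall>L Lb y v. stabilizing M w A Ab B Bb C Cb D Db L Lb \<longrightarrow>
                         closed_loop M w A Ab B Bb C Cb D Db L Lb y v \<longrightarrow> y 0 = x 0 \<longrightarrow>
                         mf_cost M Q Qb R Rb x u \<le> mf_cost M Q Qb R Rb y v) \<and>
                      mf_cost M Q Qb R Rb x u =
                        ereal ((\<integral>\<omega>. x 0 \<omega> \<bullet> (P *v x 0 \<omega>) \<partial>M) +
                               integral\<^sup>L M (x 0) \<bullet> (Pb *v integral\<^sup>L M (x 0)))))))"
proof -
  interpret prob_space M by fact
  interpret mean_field_system M w \<sigma> A Ab C Cb Q Qb B Bb D Db R Rb
    by unfold_locales fact+
  have det: detectable_forms by (rule detectable) fact+
  \<comment> \<open>The fixed-point theory speaks of \<open>(P, P + Pb)\<close>; this bijective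
    change of variables carries unique existence back to \<open>(P, Pb)\<close>.\<close>
  define f where "f = (\<lambda>(P, Pb). (P, P + Pb) :: (real^'n^'n) \<times> (real^'n^'n))"
  have "bij f"
    unfolding f_def by (rule bij_betw_byWitness[where f' = "\<lambda>(P, S). (P, S - P)"]) auto
  then have "(\<exists>!p. psd_pair p \<and> Ric p = p) \<longleftrightarrow> (\<exists>!X. psd_pair (f X) \<and> Ric (f X) = f X)"
    by (rule bij_ex1)
  also have "\<dots> \<longleftrightarrow>
      (\<exists>!X. case X of (P, Pb) \<Rightarrow> riccati_solution \<sigma> A Ab B Bb C Cb D Db Q Qb R Rb P Pb)"
    by (simp add: riccati_solution_iff f_def case_prod_beta)
  finally have iff: "ms_stabilizable M w A Ab B Bb C Cb D Db \<longleftrightarrow>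
      (\<exists>!X. case X of (P, Pb) \<Rightarrow> riccati_solution \<sigma> A Ab B Bb C Cb D Db Q Qb R Rb P Pb)"
    by (simp only: stabilizable_iff_fixpoint[OF det])
  have optimal: "let K = gain_K \<sigma> A B C D R P; Kb = gain_Kb \<sigma> A Ab B Bb C Cb D Db R Rb P Pb
      in stabilizing_gains (\<lambda>_. K) (\<lambda>_. Kb) \<and>
         (\<forall>x u. loop (\<lambda>_. K) (\<lambda>_. Kb) x u \<longrightarrow>
            (\<forall>L Lb y v. stabilizing_gains L Lb \<longrightarrow> loop L Lb y v \<longrightarrow> y 0 = x 0 \<longrightarrow>
               mf_cost M Q Qb R Rb x u \<le> mf_cost M Q Qb R Rb y v) \<and>
            mf_cost M Q Qb R Rb x u = ereal ((\<integral>\<omega>. x 0 \<omega> \<bullet> (P *v x 0 \<omega>) \<partial>M) +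
              integral\<^sup>L M (x 0) \<bullet> (Pb *v integral\<^sup>L M (x 0))))"
    if sol: "riccati_solution \<sigma> A Ab B Bb C Cb D Db Q Qb R Rb P Pb" for P Pb
  proof -
    define p where "p = (P, P + Pb)"
    have p: "psd_pair p" "Ric p = p" using sol by (simp_all add: riccati_solution_iff p_def)
    have K: "gain_K \<sigma> A B C D R P = K_dev p"
      "gain_Kb \<sigma> A Ab B Bb C Cb D Db R Rb P Pb = K_avg p - K_dev p"
      using riccati_gains[of P Pb] by (simp_all add: p_def eq_diff_eq add.commute)
    have cost_eq: "mf_cost M Q Qb R Rb x u = ereal (moment (x 0) p)"
      if "loop (\<lambda>_. K_dev p) (\<lambda>_. K_avg p - K_dev p) x u" for x u
      by (rule optimal_cost[OF det p that])
    show ?thesis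
      unfolding Let_def K
    proof (intro conjI allI impI)
      show "stabilizing_gains (\<lambda>_. K_dev p) (\<lambda>_. K_avg p - K_dev p)"
        by (rule fixpoint_imp_stabilizing[OF det p])
    next
      fix x u L Lb y v
      assume "loop (\<lambda>_. K_dev p) (\<lambda>_. K_avg p - K_dev p) x u"
        and "stabilizing_gains L Lb" "loop L Lb y v" "y 0 = x 0"
      then show "mf_cost M Q Qb R Rb x u \<le> mf_cost M Q Qb R Rb y v"
        using cost_lower_bound[of L Lb y v p] p cost_eq by simp
    next
      fix x u
      assume cl: "loop (\<lambda>_. K_dev p) (\<lambda>_. K_avg p - K_dev p) x u"
      then have "initial_state M w (x 0)" by (simp add: closed_loop_def)
      then show "mf_cost M Q Qb R Rb x u = ereal ((\<integral>\<omega>. x 0 \<omega> \<bullet> (P *v x 0 \<omega>) \<partial>M) +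
          integral\<^sup>L M (x 0) \<bullet> (Pb *v integral\<^sup>L M (x 0)))"
        by (simp add: cost_eq[OF cl] p_def moment_initial)
    qed
  qed
  show ?thesis using iff optimal by blast
qed

end
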